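(* Let $R$ be a finite commutative ring with unity and let $s\ge 0$ be an integer such that $R\cong R_0\times R_1\times\cdots\times R_s$, where each $R_i$ ($0\le i\le s$) is a finite local ring with maximal ideal $M_i$, $|R_0|/|M_0|\equiv 3\pmod 4$, and $|R_i|/|M_i|\equiv 1\pmod 4$ for all $i\in\{1,\ldots,s\}$. Then the quadratic unitary Cayley graph $\mathcal{G}_R$ is periodic if and only if $s=0$ and $R_0/M_0\cong\mathbb{Z}_3$.
   Context: $R^\times$ is the group of units of $R$; $Q_R=\{u^2:u\in R^\times\}$ and $T_R=Q_R\cup(-Q_R)$. The quadratic unitary Cayley graph $\mathcal{G}_R=\operatorname{Cay}(R,T_R)$ has vertex set $R$, with distinct $u,v$ adjacent iff $u-v\in T_R$. Grover walk on a finite simple graph $G$ without isolated vertices: arcs $\mathcal{A}(G)=\{(u,v),(v,u):uv\in E(G)\}$, for $a=(u,v)$ put $t(a)=v$, $a^{-1}=(v,u)$; boundary matrix $N_{ua}=\frac{1}{\sqrt{\deg u}}\delta_{u,t(a)}$; shift matrix $S_{ab}=\delta_{a,b^{-1}}$; time evolution matrix $U=S(2N^*N-I)$. $G$ is periodic if $U^\tau=I$ for some positive integer $\tau$. *)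

theory Defs
  imports Complex_Main "HOL-Algebra.Algebra" "Graph_Theory.Pair_Digraph"
begin
definition local_ring :: "('a, 'm) ring_scheme \<Rightarrow> bool"
  where "local_ring R \<longleftrightarrow> cring R \<and> (\<exists>!M. maximalideal M R)"

text \<open>
  Simple graphs are symmetric loop-free pair digraphs; the pairs in \<^const>\<open>parcs\<close> are then
  exactly the arcs \<open>(u, v)\<close>, \<open>(v, u)\<close> obtained from the edges \<open>uv\<close>.
\<close>

definition unit_squares :: "('a, 'm) ring_scheme \<Rightarrow> 'a set"
  where "unit_squares R = {u [^]\<^bsub>R\<^esub> (2::nat) | u. u \<in> Units R}"

definition signed_unit_squares :: "('a, 'm) ring_scheme \<Rightarrow> 'a set"
  where "signed_unit_squares R = unit_squares R \<union> (\<lambda>x. \<ominus>\<^bsub>R\<^esub> x) ` unit_squares R"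

definition cayley_graph :: "('a, 'm) ring_scheme \<Rightarrow> 'a set \<Rightarrow> 'a pair_pre_digraph"
  where "cayley_graph R T =
    \<lparr> pverts = carrier R,
      parcs = {(u, v). u \<in> carrier R \<and> v \<in> carrier R \<and> u \<noteq> v \<and> u \<ominus>\<^bsub>R\<^esub> v \<in> T} \<rparr>"

definition quadratic_unitary_cayley_graph :: "('a, 'm) ring_scheme \<Rightarrow> 'a pair_pre_digraph"
  where "quadratic_unitary_cayley_graph R = cayley_graph R (signed_unit_squares R)"

text \<open>
  Matrices are functions of two indices. Only entries with indices in the intended finite index
  sets are meaningful; the summation index set of a product is an explicit argument.
\<close>

type_synonym ('i, 'j) cmatrix = "'i \<Rightarrow> 'j \<Rightarrow> complex"

definition mat_id :: "('i, 'i) cmatrix"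
  where "mat_id = (\<lambda>i j. if i = j then 1 else 0)"

definition mat_mult :: "'k set \<Rightarrow> ('i, 'k) cmatrix \<Rightarrow> ('k, 'j) cmatrix \<Rightarrow> ('i, 'j) cmatrix"
  where "mat_mult K A B = (\<lambda>i j. \<Sum>k\<in>K. A i k * B k j)"

definition mat_adjoint :: "('i, 'j) cmatrix \<Rightarrow> ('j, 'i) cmatrix"
  where "mat_adjoint A = (\<lambda>j i. cnj (A i j))"

primrec mat_pow :: "'i set \<Rightarrow> ('i, 'i) cmatrix \<Rightarrow> nat \<Rightarrow> ('i, 'i) cmatrix"
  where
    "mat_pow K A 0 = mat_id"
  | "mat_pow K A (Suc n) = mat_mult K A (mat_pow K A n)"

text \<open>
  These definitions are meant for finite simple graphs (\<^const>\<open>pair_graph\<close>) without isolated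
  vertices. The out-degree is the degree, because the arc set is symmetric.
\<close>

definition boundary_matrix :: "'a pair_pre_digraph \<Rightarrow> ('a, 'a \<times> 'a) cmatrix"
  where "boundary_matrix G =
    (\<lambda>u a. if u = snd a then complex_of_real (1 / sqrt (real (out_degree (with_proj G) u))) else 0)"

definition shift_matrix :: "('a \<times> 'a, 'a \<times> 'a) cmatrix"
  where "shift_matrix = (\<lambda>a b. if a = prod.swap b then 1 else 0)"

definition time_evolution :: "'a pair_pre_digraph \<Rightarrow> ('a \<times> 'a, 'a \<times> 'a) cmatrix"
  where "time_evolution G =
    mat_mult (parcs G) shift_matrix
      (\<lambda>a b. 2 * mat_mult (pverts G) (mat_adjoint (boundary_matrix G)) (boundary_matrix G) a b
              - mat_id a b)"

definition grover_periodic :: "'a pair_pre_digraph \<Rightarrow> bool"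
  where "grover_periodic G \<longleftrightarrow>
    (\<exists>\<tau>>0. \<forall>a\<in>parcs G. \<forall>b\<in>parcs G. mat_pow (parcs G) (time_evolution G) \<tau> a b = mat_id a b)"

lemma (in cring) signed_unit_squares_uminus:
  assumes "x \<in> signed_unit_squares R"
  shows "\<ominus> x \<in> signed_unit_squares R"
proof -
  have "unit_squares R \<subseteq> carrier R"
    by (auto simp: unit_squares_def)
  with assms show ?thesis
    by (auto simp: signed_unit_squares_def)
qed

lemma (in cring) pair_graph_quadratic_unitary_cayley_graph:
  assumes "finite (carrier R)"
  shows "pair_graph (quadratic_unitary_cayley_graph R)"
proof -
  let ?G = "quadratic_unitary_cayley_graph R"
  have sub: "parcs ?G \<subseteq> carrier R \<times> carrier R"
    by (auto simp: quadratic_unitary_cayley_graph_def cayley_graph_def)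
  have fin: "finite (parcs ?G)"
    using finite_subset[OF sub] assms by simp
  have flip: "v \<ominus> u = \<ominus> (u \<ominus> v)" if "u \<in> carrier R" "v \<in> carrier R" for u v
    using that by (simp add: a_minus_def minus_add a_comm)
  have sym: "(v, u) \<in> parcs ?G" if "(u, v) \<in> parcs ?G" for u v
    using that signed_unit_squares_uminus[of "u \<ominus> v"] flip[of u v]
    by (auto simp: quadratic_unitary_cayley_graph_def cayley_graph_def)
  show ?thesis
  proof
    show "symmetric (with_proj ?G)"
      using sym by (auto simp: symmetric_def sym_def)
  qed (use assms fin in \<open>auto simp: quadratic_unitary_cayley_graph_def cayley_graph_def\<close>)
qed

lemma (in cring) quadratic_unitary_cayley_graph_no_isolated:
  assumes "\<one> \<noteq> \<zero>" and "u \<in> carrier R"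
  shows "\<exists>v. (u, v) \<in> parcs (quadratic_unitary_cayley_graph R)"
proof -
  have one: "\<one> \<in> signed_unit_squares R"
    by (auto simp: signed_unit_squares_def unit_squares_def intro!: exI[of _ \<one>])
  have diff: "u \<ominus> (u \<ominus> \<one>) = \<one>"
    using assms(2) by algebra
  have "u \<noteq> u \<ominus> \<one>"
    using assms diff by (metis a_minus_def r_neg)
  with one diff assms(2) show ?thesis
    by (auto simp: quadratic_unitary_cayley_graph_def cayley_graph_def intro!: exI[of _ "u \<ominus> \<one>"])
qed

end

theory Submission
  imports Defs "HOL-Combinatorics.Multiset_Permutations" "HOL-Number_Theory.Residues"
begin

text \<open>
  Let \<open>A\<close> be the adjacency matrix of a \<open>d\<close>-regular graph and \<open>U\<close> its time evolution matrix.
  Lifting a function \<open>f\<close> on vertices to arcs by \<open>a \<mapsto> f (t a)\<close> turns \<open>U + U\<^sup>-\<^sup>1\<close> into \<open>(2 / d) A\<close>.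
  If \<open>U\<close> has finite order, its powers have bounded denominators, and hence so have the matrices
  \<open>(2 / d)\<^sup>n A\<^sup>n\<close>. For a Cayley graph with connection set \<open>T\<close> of an abelian group whose order is
  prime to \<open>p\<close>, the Frobenius map of the group algebra modulo \<open>p\<close> shows that the number of walks of
  length \<open>n = p\<^sup>a\<close> from \<open>0\<close> to \<open>t \<in> T\<close> is \<open>1\<close> modulo \<open>p\<close> whenever \<open>n\<close> is \<open>1\<close> modulo the group order.
  Letting \<open>a\<close> grow, periodicity implies that \<open>2 p\<close> does not divide \<open>|T|\<close>.

  For \<open>s \<ge> 1\<close> this fails with \<open>p = 2\<close>: since \<open>-1\<close> is a square in \<open>R\<^sub>1\<close>, the group \<open>T\<close> contains
  the Klein four-group generated by \<open>-1\<close> and \<open>(1, -1, 1, \<dots>, 1)\<close>. For \<open>s = 0\<close> one has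
  \<open>T = R\<^sup>\<times>\<close>, of order \<open>(q - 1) |M|\<close> with \<open>q = |R / M|\<close>, and every prime factor \<open>p\<close> of \<open>(q - 1) / 2\<close>
  contradicts periodicity, so \<open>q = 3\<close>. Conversely, for \<open>q = 3\<close> the graph is complete tripartite with
  equal parts, and \<open>U\<^sup>1\<^sup>2 = I\<close>.
\<close>

section \<open>The Grover walk on a regular graph\<close>

locale regular_graph = pair_graph G for G :: "'a pair_pre_digraph" +
  fixes d :: nat
  assumes regular: "u \<in> pverts G \<Longrightarrow> card {v. (u, v) \<in> parcs G} = d"
    and degree_pos: "0 < d"
begin

section \<open>The time evolution matrix as an operator on functions on arcs\<close>

definition grover :: "('a \<times> 'a \<Rightarrow> complex) \<Rightarrow> 'a \<times> 'a \<Rightarrow> complex"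
  where "grover \<phi> a = 2 / of_nat d * (\<Sum>v | (fst a, v) \<in> parcs G. \<phi> (v, fst a)) - \<phi> (prod.swap a)"

text \<open>The operator (2/d) A, that is, twice the transition operator of the simple random
  walk.\<close>

definition step :: "('a \<Rightarrow> complex) \<Rightarrow> 'a \<Rightarrow> complex"
  where "step f u = 2 / of_nat d * (\<Sum>v | (u, v) \<in> parcs G. f v)"

lemma swap_arc: "prod.swap a \<in> parcs G \<longleftrightarrow> a \<in> parcs G"
  by (cases a) (auto intro: arcs_symmetric)

lemma out_degree_eq: "out_degree (with_proj G) u = d" if "u \<in> pverts G"
proof -
  have "out_arcs (with_proj G) u = Pair u ` {v. (u, v) \<in> parcs G}"
    by (auto simp: out_arcs_def)
  then show ?thesis
    using regular[OF that] by (simp add: out_degree_def card_image inj_on_def)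
qed

text \<open>The shift replaces the row index \<open>a\<close> by its reversal, whose head is
  \<open>fst a\<close>. By regularity the adjoint of the boundary matrix times the boundary matrix
  has entry 1/d at two arcs with the same head, and 0 otherwise.\<close>

lemma time_evolution_entry:
  assumes "a \<in> parcs G" "b \<in> parcs G"
  shows "time_evolution G a b =
    (if snd b = fst a then 2 / of_nat d else 0) - (if b = prod.swap a then 1 else 0)"
proof -
  let ?N = "boundary_matrix G"
  let ?C = "\<lambda>a b. 2 * mat_mult (pverts G) (mat_adjoint ?N) ?N a b - mat_id a b"
  have vert: "fst a \<in> pverts G"
    using assms by (simp add: arc_fst_in_verts)
  have "time_evolution G a b = (\<Sum>k\<in>parcs G. if k = prod.swap a then ?C k b else 0)"
    unfolding time_evolution_def mat_mult_def shift_matrix_def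
    by (intro sum.cong) auto
  also have "\<dots> = ?C (prod.swap a) b"
    using assms by (simp add: sum.delta pair_finite_arcs swap_arc)
  also have "mat_mult (pverts G) (mat_adjoint ?N) ?N (prod.swap a) b =
    (\<Sum>u\<in>pverts G. if u = fst a then (if snd b = fst a then 1 / of_nat d else 0) else 0)"
    unfolding mat_mult_def mat_adjoint_def boundary_matrix_def
    using degree_pos
    by (intro sum.cong) (auto simp: out_degree_eq simp flip: of_real_mult)
  also have "\<dots> = (if snd b = fst a then 1 / of_nat d else 0)"
    using vert by (simp add: sum.delta pair_finite_verts)
  finally show ?thesis
    by (auto simp: mat_id_def)
qed

lemma grover_eq_time_evolution:
  assumes "a \<in> parcs G"
  shows "grover \<phi> a = (\<Sum>b\<in>parcs G. time_evolution G a b * \<phi> b)"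
proof -
  have inn: "{b \<in> parcs G. snd b = fst a} = (\<lambda>v. (v, fst a)) ` {v. (fst a, v) \<in> parcs G}"
    by (auto simp: image_iff intro: arcs_symmetric)
  have "(\<Sum>b\<in>parcs G. time_evolution G a b * \<phi> b) =
    (\<Sum>b\<in>parcs G. if snd b = fst a then 2 / of_nat d * \<phi> b else 0) -
    (\<Sum>b\<in>parcs G. if b = prod.swap a then \<phi> b else 0)"
    unfolding sum_subtractf[symmetric]
    by (intro sum.cong refl) (simp add: time_evolution_entry[OF assms] left_diff_distrib)
  also have "(\<Sum>b\<in>parcs G. if b = prod.swap a then \<phi> b else 0) = \<phi> (prod.swap a)"
    using assms by (simp add: sum.delta pair_finite_arcs swap_arc)
  also have "(\<Sum>b\<in>parcs G. if snd b = fst a then 2 / of_nat d * \<phi> b else 0) =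
    (\<Sum>b | b \<in> parcs G \<and> snd b = fst a. 2 / of_nat d * \<phi> b)"
    by (rule sum.inter_filter[OF pair_finite_arcs, symmetric])
  also have "\<dots> = 2 / of_nat d * (\<Sum>v | (fst a, v) \<in> parcs G. \<phi> (v, fst a))"
    unfolding inn by (simp add: sum.reindex inj_on_def sum_distrib_left)
  finally show ?thesis
    by (simp add: grover_def)
qed

lemma grover_cong:
  assumes "\<And>a. a \<in> parcs G \<Longrightarrow> \<phi> a = \<psi> a" and "a \<in> parcs G"
  shows "grover \<phi> a = grover \<psi> a"
  using assms by (simp add: grover_eq_time_evolution)

text \<open>Identities such as a period or \<open>grover_target\<close> hold on arcs only, not as
  equations between functions; this allows substituting them inside powers of the walk.\<close>

lemma grover_pow_cong:
  assumes "\<And>a. a \<in> parcs G \<Longrightarrow> \<phi> a = \<psi> a" and "a \<in> parcs G"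
  shows "(grover ^^ n) \<phi> a = (grover ^^ n) \<psi> a"
  using assms(2) by (induction n arbitrary: a) (auto simp: assms(1) intro: grover_cong)

lemma grover_add: "grover (\<lambda>a. \<phi> a + \<psi> a) = (\<lambda>a. grover \<phi> a + grover \<psi> a)"
  by (auto simp: grover_def sum.distrib algebra_simps)

lemma grover_pow_add: "(grover ^^ n) (\<lambda>a. \<phi> a + \<psi> a) = (\<lambda>a. (grover ^^ n) \<phi> a + (grover ^^ n) \<psi> a)"
  by (induction n) (auto simp: grover_add)

lemma mat_pow_time_evolution:
  assumes "a \<in> parcs G"
  shows "(\<Sum>b\<in>parcs G. mat_pow (parcs G) (time_evolution G) n a b * \<phi> b) = (grover ^^ n) \<phi> a"
  using assms
proof (induction n arbitrary: a)
  case 0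
  then show ?case
    using sum.delta[OF pair_finite_arcs, of a \<phi>]
    by (simp add: mat_id_def if_distrib[of "\<lambda>x. x * _"] cong: if_cong)
next
  case (Suc n)
  let ?U = "time_evolution G" and ?P = "mat_pow (parcs G) (time_evolution G) n"
  have "(\<Sum>b\<in>parcs G. mat_pow (parcs G) ?U (Suc n) a b * \<phi> b) =
    (\<Sum>b\<in>parcs G. \<Sum>k\<in>parcs G. ?U a k * (?P k b * \<phi> b))"
    by (simp add: mat_mult_def sum_distrib_right mult.assoc)
  also have "\<dots> = (\<Sum>k\<in>parcs G. ?U a k * (\<Sum>b\<in>parcs G. ?P k b * \<phi> b))"
    by (subst sum.swap) (simp add: sum_distrib_left)
  also have "\<dots> = (\<Sum>k\<in>parcs G. ?U a k * (grover ^^ n) \<phi> k)"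
    using Suc.IH by simp
  finally show ?case
    using grover_eq_time_evolution[OF Suc.prems] by simp
qed

lemma grover_periodic_iff:
  "grover_periodic G \<longleftrightarrow> (\<exists>\<tau>>0. \<forall>\<phi>. \<forall>a\<in>parcs G. (grover ^^ \<tau>) \<phi> a = \<phi> a)"
proof -
  have "(\<forall>a\<in>parcs G. \<forall>b\<in>parcs G. mat_pow (parcs G) (time_evolution G) \<tau> a b = mat_id a b) \<longleftrightarrow>
    (\<forall>\<phi>. \<forall>a\<in>parcs G. (grover ^^ \<tau>) \<phi> a = \<phi> a)" (is "?L \<longleftrightarrow> ?R") for \<tau>
  proof
    assume L: ?L
    show ?R
    proof (intro allI ballI)
      fix \<phi> a assume a: "a \<in> parcs G"
      have "(grover ^^ \<tau>) \<phi> a = (\<Sum>b\<in>parcs G. mat_id a b * \<phi> b)"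
        using L a by (simp flip: mat_pow_time_evolution)
      also have "\<dots> = \<phi> a"
        using mat_pow_time_evolution[OF a, of 0 \<phi>] by simp
      finally show "(grover ^^ \<tau>) \<phi> a = \<phi> a" .
    qed
  next
    assume R: ?R
    show ?L
    proof (intro ballI)
      fix a b assume a: "a \<in> parcs G" and b: "b \<in> parcs G"
      let ?\<delta> = "\<lambda>c. if c = b then 1 else (0 :: complex)"
      have "mat_pow (parcs G) (time_evolution G) \<tau> a b = (grover ^^ \<tau>) ?\<delta> a"
        using b pair_finite_arcs
        by (simp add: mat_pow_time_evolution[OF a, symmetric] if_distrib sum.delta cong: if_cong)
      then show "mat_pow (parcs G) (time_evolution G) \<tau> a b = mat_id a b"
        using R a by (simp add: mat_id_def)
    qed
  qed
  then show ?thesis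
    by (simp add: grover_periodic_def)
qed

section \<open>Functions lifted from vertices, and denominators of powers\<close>

lemma grover_target: "grover (\<lambda>a. f (snd a)) a = f (fst a)" if "a \<in> parcs G"
  using that degree_pos regular[of "fst a"]
  by (cases a) (auto simp: grover_def dest: in_arcsD1)

text \<open>Write f' for the lift \<open>\<lambda>a. f (snd a)\<close>. Combined with
  \<open>grover_target\<close> this gives U^2 f' = U (step f)' - f' on arcs, the relation between
  the walk and the adjacency matrix.\<close>

lemma grover_source: "grover (\<lambda>a. f (fst a)) a = step f (fst a) - f (snd a)"
  by (simp add: grover_def step_def)

text \<open>The entries of d U are integers, so n steps cost at most the denominator d^n.\<close>

lemma grover_pow_denominator:
  assumes "\<And>a. a \<in> parcs G \<Longrightarrow> \<phi> a \<in> \<int>" and "a \<in> parcs G"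
  shows "of_nat d ^ n * (grover ^^ n) \<phi> a \<in> \<int>"
  using assms(2)
proof (induction n arbitrary: a)
  case 0
  then show ?case by (simp add: assms)
next
  case (Suc n)
  let ?\<psi> = "\<lambda>a. of_nat d ^ n * (grover ^^ n) \<phi> a"
  have "of_nat d ^ Suc n * (grover ^^ Suc n) \<phi> a =
    2 * (\<Sum>v | (fst a, v) \<in> parcs G. ?\<psi> (v, fst a)) - of_nat d * ?\<psi> (prod.swap a)"
    using degree_pos by (simp add: grover_def sum_distrib_left algebra_simps)
  moreover have "(\<Sum>v | (fst a, v) \<in> parcs G. ?\<psi> (v, fst a)) \<in> \<int>"
    by (intro Ints_sum Suc.IH) (use arcs_symmetric in blast)
  moreover have "?\<psi> (prod.swap a) \<in> \<int>"
    using Suc.prems by (intro Suc.IH) (simp add: swap_arc)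
  ultimately show ?case
    by (metis Ints_diff Ints_mult Ints_numeral Ints_of_nat)
qed

text \<open>Under a period \<tau> all powers of U have denominators dividing d^\<tau>, and
  \<open>step\<close> acts on lifted functions as U + U^(-1). Expanding the n-th power of this sum
  expresses the lift of \<open>(step ^^ n) f\<close> by powers of U applied to the lift of f, so the
  bound is independent of n.\<close>

lemma step_pow_bounded_denominator:
  assumes period: "\<tau> > 0" "\<And>\<phi> a. a \<in> parcs G \<Longrightarrow> (grover ^^ \<tau>) \<phi> a = \<phi> a"
    and f: "\<And>u. u \<in> pverts G \<Longrightarrow> f u \<in> \<int>"
    and u: "u \<in> pverts G"
  shows "of_nat d ^ \<tau> * (step ^^ n) f u \<in> \<int>"
proof -
  have shift: "(grover ^^ (k + \<tau>)) \<phi> a = (grover ^^ k) \<phi> a" if "a \<in> parcs G" for k \<phi> a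
    using grover_pow_cong[OF period(2)] that by (simp add: funpow_add)
  \<comment> \<open>Reducing the exponent modulo \<tau> leaves some k < \<tau>, and d^k divides
    d^\<tau>.\<close>
  have base: "of_nat d ^ \<tau> * (grover ^^ k) \<phi> a \<in> \<int>"
    if \<phi>: "\<And>a. a \<in> parcs G \<Longrightarrow> \<phi> a \<in> \<int>" and a: "a \<in> parcs G" for k \<phi> a
  proof (induction k rule: less_induct)
    case (less k)
    show ?case
    proof (cases "k < \<tau>")
      case True
      then have "of_nat d ^ \<tau> = (of_nat d ^ (\<tau> - k) * of_nat d ^ k :: complex)"
        by (simp flip: power_add)
      then show ?thesis
        using grover_pow_denominator[of \<phi> a k] \<phi> a by (simp add: mult.assoc Ints_mult)
    next
      case False
      then show ?thesis
        using less[of "k - \<tau>"] shift[OF a, of "k - \<tau>" \<phi>] period(1) by simp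
    qed
  qed
  \<comment> \<open>The inverse of U is written as its power \<tau> - 1. The identity is first
    proved after one more application of U, where no inverse occurs.\<close>
  have step: "(grover ^^ k) (\<lambda>a. step f (snd a)) a =
    (grover ^^ (k + 1)) (\<lambda>a. f (snd a)) a + (grover ^^ (k + (\<tau> - 1))) (\<lambda>a. f (snd a)) a"
    if a: "a \<in> parcs G" for f k a
  proof -
    let ?g = "\<lambda>a. step f (snd a)" and ?f = "\<lambda>a. f (snd a)"
    have eq: "(grover ^^ 1) ?g b = (grover ^^ 2) ?f b + ?f b" if b: "b \<in> parcs G" for b
    proof -
      have "(grover ^^ 2) ?f b = grover (\<lambda>a. f (fst a)) b"
        using grover_cong[OF grover_target b] by (simp add: eval_nat_numeral)
      then show ?thesis
        by (simp add: grover_target b grover_source)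
    qed
    have "(grover ^^ k) ?g a = (grover ^^ (k + \<tau>)) ?g a"
      by (simp add: shift a)
    also have "\<dots> = (grover ^^ (k + (\<tau> - 1))) ((grover ^^ 1) ?g) a"
    proof -
      have "k + \<tau> = k + (\<tau> - 1) + 1"
        using period(1) by simp
      then show ?thesis
        by (simp only: funpow_add o_apply)
    qed
    also have "\<dots> = (grover ^^ (k + (\<tau> - 1))) (\<lambda>b. (grover ^^ 2) ?f b + ?f b) a"
      by (rule grover_pow_cong[OF eq a])
    also have "\<dots> = (grover ^^ (k + 1 + \<tau>)) ?f a + (grover ^^ (k + (\<tau> - 1))) ?f a"
    proof -
      have "k + 1 + \<tau> = k + (\<tau> - 1) + 2"
        using period(1) by simp
      then show ?thesis
        by (simp only: grover_pow_add funpow_add o_apply)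
    qed
    finally show ?thesis
      by (simp only: shift[OF a])
  qed
  \<comment> \<open>The exponent k stays general because each \<open>step\<close> splits a term into
    two with different exponents.\<close>
  have main: "of_nat d ^ \<tau> * (grover ^^ k) (\<lambda>a. (step ^^ n) f (snd a)) a \<in> \<int>"
    if "a \<in> parcs G" for a k
  proof (induction n arbitrary: k)
    case 0
    show ?case
      using that by (intro base) (auto simp: f arc_snd_in_verts)
  next
    case (Suc n)
    show ?case
      using Suc[of "k + 1"] Suc[of "k + (\<tau> - 1)"]
      by (simp only: funpow.simps o_apply step[OF that] distrib_left Ints_add)
  qed
  \<comment> \<open>Some arc ends in u, and the lift takes the value at u there.\<close>
  have "{v. (u, v) \<in> parcs G} \<noteq> {}"
    using regular[OF u] degree_pos by (metis card.empty less_irrefl)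
  then obtain v where "(v, u) \<in> parcs G"
    by (auto intro: arcs_symmetric)
  from main[OF this, of 0] show ?thesis
    by simp
qed

section \<open>A quadratic condition on the adjacency operator that forces period twelve\<close>

definition inflow :: "('a \<times> 'a \<Rightarrow> complex) \<Rightarrow> 'a \<Rightarrow> complex"
  where "inflow \<phi> u = 2 / of_nat d * (\<Sum>v | (u, v) \<in> parcs G. \<phi> (v, u))"

definition total :: "('a \<Rightarrow> complex) \<Rightarrow> complex"
  where "total f = (\<Sum>u\<in>pverts G. f u)"

lemma step_add: "step (\<lambda>u. f u + g u) = (\<lambda>u. step f u + step g u)"
  by (simp add: step_def sum.distrib distrib_left fun_eq_iff)

lemma step_uminus: "step (\<lambda>u. - f u) = (\<lambda>u. - step f u)"
  by (simp add: step_def sum_negf fun_eq_iff)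

lemma step_const: "step (\<lambda>_. c) u = 2 * c" if "u \<in> pverts G"
  using regular[OF that] degree_pos by (simp add: step_def)

lemma sum_neighbours_swap:
  "(\<Sum>u\<in>pverts G. \<Sum>v | (u, v) \<in> parcs G. h u v) = (\<Sum>u\<in>pverts G. \<Sum>v | (u, v) \<in> parcs G. h v u)"
proof -
  have eq: "{v. (u, v) \<in> parcs G} = {v \<in> pverts G. (u, v) \<in> parcs G}"
    "{v. (u, v) \<in> parcs G} = {v \<in> pverts G. (v, u) \<in> parcs G}" for u
    by (auto dest: in_arcsD2 arcs_symmetric)
  show ?thesis
    unfolding eq(1)
    by (subst sum.swap_restrict[OF pair_finite_verts pair_finite_verts])
      (simp only: eq(1)[symmetric] eq(2)[symmetric])
qed

lemma total_step: "total (step f) = 2 * total f"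
proof -
  have "total (step f) = 2 / of_nat d * (\<Sum>u\<in>pverts G. \<Sum>v | (u, v) \<in> parcs G. f v)"
    by (simp add: total_def step_def sum_distrib_left)
  also have "(\<Sum>u\<in>pverts G. \<Sum>v | (u, v) \<in> parcs G. f v) = (\<Sum>u\<in>pverts G. of_nat d * f u)"
    by (subst sum_neighbours_swap) (simp add: regular)
  also have "2 / of_nat d * \<dots> = 2 * total f"
    using degree_pos by (simp add: total_def flip: sum_distrib_left)
  finally show ?thesis .
qed

lemma grover_inflow: "grover \<phi> a = inflow \<phi> (fst a) - \<phi> (prod.swap a)"
  by (simp add: grover_def inflow_def)

text \<open>U^2 differs from the identity only by a function of the shape F (snd a) + H (fst a). By
  \<open>grover_pair\<close> such functions are closed under U, which moves the question from arcs
  to vertices.\<close>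

lemma grover_twice:
  "grover (grover \<phi>) a = \<phi> a + (- inflow \<phi> (snd a) + inflow (grover \<phi>) (fst a))"
  by (simp add: grover_inflow)

text \<open>The new inflow is \<open>step (inflow \<phi>)\<close> minus an outflow. The first has
  twice the total of the inflow; the outflow has the same total as the inflow, since every arc has
  one head and one tail.\<close>

lemma total_inflow_grover: "total (inflow (grover \<phi>)) = total (inflow \<phi>)"
proof -
  have "inflow (grover \<phi>) u =
    step (inflow \<phi>) u - 2 / of_nat d * (\<Sum>v | (u, v) \<in> parcs G. \<phi> (u, v))" for u
    by (simp add: inflow_def[of "grover \<phi>"] grover_inflow step_def sum_subtractf algebra_simps)
  then have "total (inflow (grover \<phi>)) =
    total (step (inflow \<phi>)) - (\<Sum>u\<in>pverts G. 2 / of_nat d * (\<Sum>v | (u, v) \<in> parcs G. \<phi> (u, v)))"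
    by (simp add: total_def sum_subtractf)
  also have "(\<Sum>u\<in>pverts G. 2 / of_nat d * (\<Sum>v | (u, v) \<in> parcs G. \<phi> (u, v))) = total (inflow \<phi>)"
    unfolding total_def inflow_def sum_distrib_left[symmetric]
    by (subst sum_neighbours_swap) simp
  finally show ?thesis
    by (simp add: total_step)
qed

lemma grover_pair:
  assumes "a \<in> parcs G"
  shows "grover (\<lambda>a. f (snd a) + g (fst a)) a = - g (snd a) + (f (fst a) + step g (fst a))"
  using grover_target[OF assms, of f] by (simp add: grover_add grover_source)

text \<open>
  The hypothesis says that \<open>(2 / d) A\<close> has eigenvalues \<open>-1\<close> and \<open>0\<close> on functions of total \<open>0\<close>;
  the corresponding eigenvalues of the walk have orders \<open>3\<close> and \<open>4\<close>.
\<close>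
lemma grover_periodic_12:
  assumes step_quadratic: "\<And>f u. u \<in> pverts G \<Longrightarrow> step (step f) u + step f u = \<kappa> * total f"
  shows "grover_periodic G"
proof -
  have "(grover ^^ 12) \<phi> a = \<phi> a" if a: "a \<in> parcs G" for \<phi> a
  proof -
    \<comment> \<open>Here \<delta> = (U^2 - I) \<phi> and \<chi> = (U^4 - I) \<phi>. The aim is
      (U^2 + U + I) \<chi> = 0 on arcs.\<close>
    define F H where "F = (\<lambda>u. - inflow \<phi> u)" and "H = inflow (grover \<phi>)"
    define \<delta> where "\<delta> = (\<lambda>a. F (snd a) + H (fst a))"
    define \<chi> where "\<chi> = (\<lambda>a. \<delta> a + (grover ^^ 2) \<delta> a)"
    have vert: "fst b \<in> pverts G" "snd b \<in> pverts G" if "b \<in> parcs G" for b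
      using that by (auto intro: arc_fst_in_verts arc_snd_in_verts)
    have two: "(grover ^^ 2) \<psi> = grover (grover \<psi>)" for \<psi>
      by (simp add: eval_nat_numeral)
    have iterate: "(grover ^^ (n + 2)) \<phi> a = (grover ^^ n) \<phi> a + (grover ^^ n) \<delta> a" for n
    proof -
      have "(grover ^^ 2) \<phi> = (\<lambda>a. \<phi> a + \<delta> a)"
        by (simp add: two grover_twice \<delta>_def F_def H_def fun_eq_iff)
      then show ?thesis
        by (simp only: funpow_add o_apply grover_pow_add)
    qed
    define x where "x n = (grover ^^ n) \<chi> a" for n
    have iterate_X: "x n = (grover ^^ n) \<delta> a + (grover ^^ (n + 2)) \<delta> a" for n
      by (simp only: x_def \<chi>_def funpow_add o_apply grover_pow_add)
    \<comment> \<open>Preservation of the total inflow makes the constants that the hypothesis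
      yields for F and H opposite, namely -c and c.\<close>
    have total: "total F + total H = 0"
      by (simp add: F_def H_def total_inflow_grover) (simp add: total_def sum_negf)

    \<comment> \<open>By \<open>D1\<close> and \<open>D2\<close>, h and k are the target part and
      the source part of \<chi>. On both, \<open>step\<close> acts as -1 up to adding a constant,
      which makes three consecutive iterates of \<chi> sum to 0.\<close>
    define h where "h = (\<lambda>u. - step H u)"
    define k where "k = (\<lambda>u. step F u + step (step H) u)"
    define c where "c = \<kappa> * total H"
    have total_F: "\<kappa> * total F = - c"
      using total by (simp add: c_def add_eq_0_iff)
    have step_h: "step h u = - c - h u" if "u \<in> pverts G" for u
      using step_quadratic[OF that, of H]
      by (simp add: h_def c_def step_uminus algebra_simps)
    have step_k: "step k u = c - k u" if "u \<in> pverts G" for u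
      using step_quadratic[OF that, of F] step_quadratic[OF that, of "step H"] total_F
      by (simp add: k_def step_add total_step c_def algebra_simps)

    have D1: "grover \<delta> b = - H (snd b) + (F (fst b) + step H (fst b))" if "b \<in> parcs G" for b
      unfolding \<delta>_def by (rule grover_pair[OF that])
    have D2: "grover (grover \<delta>) b =
      - (F (snd b) + step H (snd b)) + (- H (fst b) + (step F (fst b) + step (step H) (fst b)))"
      if "b \<in> parcs G" for b
      using grover_cong[OF D1 that] grover_pair[OF that, of "\<lambda>u. - H u" "\<lambda>u. F u + step H u"]
      by (simp add: step_add)
    have X0: "\<chi> b = h (snd b) + k (fst b)" if "b \<in> parcs G" for b
      using D2[OF that] by (simp add: \<chi>_def \<delta>_def two h_def k_def)
    have X1: "grover \<chi> b = - k (snd b) + (h (fst b) + c - k (fst b))" if "b \<in> parcs G" for b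
      using grover_cong[OF X0 that] grover_pair[OF that, of h k] step_k[of "fst b"] vert[OF that]
      by simp
    have X2: "grover (grover \<chi>) b = - (h (snd b) + c - k (snd b)) + (- h (fst b))"
      if b: "b \<in> parcs G" for b
    proof -
      have "step (\<lambda>u. h u + c - k u) (fst b) = step h (fst b) + 2 * c - step k (fst b)"
        using vert[OF b] step_add[of "\<lambda>u. h u + c" "\<lambda>u. - k u"] step_add[of h "\<lambda>_. c"]
        by (simp add: step_uminus step_const)
      then show ?thesis
        using grover_cong[OF X1 b] grover_pair[OF b, of "\<lambda>u. - k u" "\<lambda>u. h u + c - k u"]
          step_h[of "fst b"] step_k[of "fst b"] vert[OF b]
        by simp
    qed
    have X_sum: "\<chi> b + grover \<chi> b + grover (grover \<chi>) b = 0" if "b \<in> parcs G" for b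
      by (simp add: X0 X1 X2 that)
    have "grover (\<lambda>b. \<chi> b + grover \<chi> b + grover (grover \<chi>) b) b = 0" if "b \<in> parcs G" for b
    proof -
      have "grover (\<lambda>b. \<chi> b + grover \<chi> b + grover (grover \<chi>) b) b = grover (\<lambda>_. 0) b"
        by (rule grover_cong[OF X_sum that])
      then show ?thesis
        by (simp add: grover_def[of "\<lambda>_. 0"])
    qed
    then have X_sum': "grover \<chi> b + grover (grover \<chi>) b + grover (grover (grover \<chi>)) b = 0"
      if "b \<in> parcs G" for b
      using that by (simp add: grover_add)
    have X3: "(grover ^^ 3) \<chi> b = \<chi> b" if "b \<in> parcs G" for b
    proof -
      have "grover (grover (grover \<chi>)) b = \<chi> b"
      proof -
        let ?s = "grover \<chi> b + grover (grover \<chi>) b"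
        have "grover (grover (grover \<chi>)) b + ?s = \<chi> b + ?s"
          using X_sum[OF that] X_sum'[OF that] by (simp add: add_ac)
        then show ?thesis
          by simp
      qed
      then show ?thesis
        by (simp add: eval_nat_numeral)
    qed
    have X4: "(grover ^^ (n + 3)) \<chi> a = (grover ^^ n) \<chi> a" for n
      using grover_pow_cong[OF X3 a] by (simp only: funpow_add o_apply)
    \<comment> \<open>This is U^12 - I = (I + U^4 + U^8) (U^4 - I), where g, e, x stand for the
      iterates of \<phi>, \<delta>, \<chi> at the arc \<open>a\<close>. As U^3 fixes \<chi>, the
      exponents 0, 4, 8 then reduce to 0, 1, 2.\<close>
    have telescope: "g 12 = g 0 + x 0 + x 4 + x 8"
      if "\<And>n. g (n + 2) = g n + e n" "\<And>n. x n = e n + e (n + 2)" for g e :: "nat \<Rightarrow> complex"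
    proof -
      have "g 2 = g 0 + e 0" "x 0 = e 0 + e 2"
        using that(1)[of 0] that(2)[of 0] by (simp_all only: add_0)
      then show ?thesis
        using that(1)[of 2] that(1)[of 4] that(1)[of 6] that(1)[of 8] that(1)[of 10]
          that(2)[of 4] that(2)[of 8]
        by simp
    qed
    have "(grover ^^ 12) \<phi> a = (grover ^^ 0) \<phi> a + x 0 + x 4 + x 8"
      by (rule telescope[OF iterate iterate_X])
    moreover have "x (n + 3) = x n" for n
      unfolding x_def by (rule X4)
    from this[of 1] this[of 2] this[of 5] have "x 4 = x 1" "x 8 = x 2"
      by simp_all
    moreover have "x 0 + x 1 + x 2 = 0"
      using X_sum[OF a] by (simp add: x_def two)
    ultimately show ?thesis
      by (simp add: add.assoc)
  qed
  then show ?thesis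
    unfolding grover_periodic_iff by (intro exI[of _ 12]) auto
qed

text \<open>A vertex misses exactly its own class, so \<open>step f\<close> is (total f - class sum)
  / m and is constant on classes. Applying this formula to \<open>step f\<close> gives the quadratic
  relation of \<open>grover_periodic_12\<close> with \<kappa> = 2/m.\<close>

lemma tripartite_imp_grover_periodic:
  assumes arcs: "\<And>u v. u \<in> pverts G \<Longrightarrow> v \<in> pverts G \<Longrightarrow> (u, v) \<in> parcs G \<longleftrightarrow> col u \<noteq> col v"
    and col_class: "\<And>u. u \<in> pverts G \<Longrightarrow> card {v \<in> pverts G. col v = col u} = m"
    and order: "card (pverts G) = 3 * m"
  shows "grover_periodic G"
\<comment> \<open>Without a vertex, regularity gives no relation between d and m, but then there are
  no arcs either.\<close>
proof (cases "pverts G = {}")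
  case True
  then have "parcs G = {}"
    using arc_fst_in_verts by blast
  then show ?thesis
    by (auto simp: grover_periodic_def)
next
  case False
  let ?class = "\<lambda>u. {v \<in> pverts G. col v = col u}"
  have nb: "{v. (u, v) \<in> parcs G} = pverts G - ?class u" if "u \<in> pverts G" for u
    using that arcs by (auto dest: in_arcsD2)
  have fin: "finite (?class u)" for u
    using pair_finite_verts by simp
  obtain u where u: "u \<in> pverts G"
    using False by auto
  have d: "d = 2 * m"
    using regular[OF u] col_class[OF u] order card_Diff_subset[OF fin, of u "pverts G"]
    by (simp add: nb[OF u] subset_eq)
  then have m: "m > 0"
    using degree_pos by simp
  have step_eq: "step f u = (total f - (\<Sum>v\<in>?class u. f v)) / of_nat m" if "u \<in> pverts G" for f u
  proof -
    have "(\<Sum>v | (u, v) \<in> parcs G. f v) = total f - (\<Sum>v\<in>?class u. f v)"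
      unfolding nb[OF that] total_def by (rule sum_diff[OF pair_finite_verts]) auto
    moreover have "of_nat d = (2 * of_nat m :: complex)"
      by (simp add: d)
    ultimately show ?thesis
      unfolding step_def by (simp only: times_divide_eq_left mult_divide_mult_cancel_left_if) simp
  qed
  show ?thesis
  proof (rule grover_periodic_12[where \<kappa> = "2 / of_nat m"])
    fix f u assume u: "u \<in> pverts G"
    have "(\<Sum>v\<in>?class u. step f v) = (\<Sum>v\<in>?class u. step f u)"
      using u by (intro sum.cong) (auto simp: step_eq)
    also have "\<dots> = of_nat m * step f u"
      by (simp add: col_class[OF u])
    finally show "step (step f) u + step f u = 2 / of_nat m * total f"
      using m step_eq[OF u, of "step f"] by (simp add: total_step field_simps)
  qed
qed

end

section \<open>Walks of prime power length\<close>

text \<open>The number of orderings is a multinomial coefficient. Its product with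
  \<open>count A x\<close> is a multiple of \<open>size A\<close>, by marking one occurrence of x.
  If p did not divide the coefficient, p^n would divide \<open>count A x\<close>, forcing all
  elements to equal x.\<close>

lemma prime_dvd_card_permutations_of_multiset:
  fixes A :: "'a multiset"
  assumes "Factorial_Ring.prime p" and size: "size A = p ^ n" and nonconst: "\<nexists>t. A = replicate_mset (p ^ n) t"
  shows "p dvd card (permutations_of_multiset A)"
proof (rule ccontr)
  assume "\<not> p dvd card (permutations_of_multiset A)"
  then have cop: "coprime (p ^ n) (card (permutations_of_multiset A))"
    using \<open>Factorial_Ring.prime p\<close> by (simp add: prime_imp_coprime)
  have "A \<noteq> {#}"
    using size prime_gt_0_nat[OF \<open>Factorial_Ring.prime p\<close>] by auto
  then obtain x where x: "x \<in># A"
    by blast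
  have "p ^ n dvd card (permutations_of_multiset A) * count A x"
    by (simp add: card_permutations_of_multiset_remove_aux[OF x] size)
  then have "p ^ n dvd count A x"
    using cop by (simp add: coprime_dvd_mult_right_iff)
  then have "size A \<le> count A x"
    using x size by (simp add: dvd_imp_le)
  moreover have part: "A = replicate_mset (count A x) x + filter_mset (\<lambda>y. y \<noteq> x) A"
    using multiset_partition[of A "\<lambda>y. y = x"] by (simp add: filter_eq_replicate_mset)
  then have "size A = count A x + size (filter_mset (\<lambda>y. y \<noteq> x) A)"
    by (metis size_replicate_mset size_union)
  ultimately have "filter_mset (\<lambda>y. y \<noteq> x) A = {#}"
    by simp
  with part have "A = replicate_mset (count A x) x"
    by simp
  then show False
    using nonconst size by (metis size_replicate_mset)
qed

text \<open>Words are grouped by their multiset, on which alone P depends. A nonconstant multiset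
  contributes a multiple of p, a constant one exactly one word.\<close>

lemma card_lists_mod_prime:
  fixes T :: "'a set"
  assumes "finite T" and "Factorial_Ring.prime p"
  shows "[card {xs. length xs = p ^ n \<and> set xs \<subseteq> T \<and> P (mset xs)} =
    card {t \<in> T. P (replicate_mset (p ^ n) t)}] (mod p)"
proof -
  define \<A> where "\<A> = mset ` {xs. length xs = p ^ n \<and> set xs \<subseteq> T \<and> P (mset xs)}"
  define \<C> where "\<C> = replicate_mset (p ^ n) ` {t \<in> T. P (replicate_mset (p ^ n) t)}"
  have pos: "p ^ n > 0"
    using prime_gt_0_nat[OF \<open>Factorial_Ring.prime p\<close>] by simp
  have fin: "finite \<A>"
    unfolding \<A>_def
    by (rule finite_imageI, rule finite_subset[OF _ finite_lists_length_eq[OF \<open>finite T\<close>]]) auto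
  have sub: "\<C> \<subseteq> \<A>"
  proof
    fix A assume "A \<in> \<C>"
    then obtain t where t: "t \<in> T" "P (replicate_mset (p ^ n) t)" "A = replicate_mset (p ^ n) t"
      by (auto simp: \<C>_def)
    then show "A \<in> \<A>"
      unfolding \<A>_def by (intro image_eqI[of _ _ "replicate (p ^ n) t"]) auto
  qed
  have "{xs. length xs = p ^ n \<and> set xs \<subseteq> T \<and> P (mset xs)} = (\<Union>A\<in>\<A>. permutations_of_multiset A)"
  proof (intro equalityI subsetI)
    fix xs assume "xs \<in> (\<Union>A\<in>\<A>. permutations_of_multiset A)"
    then obtain ys where "length ys = p ^ n" "set ys \<subseteq> T" "P (mset ys)" "mset xs = mset ys"
      by (auto simp: \<A>_def permutations_of_multiset_def)
    then show "xs \<in> {xs. length xs = p ^ n \<and> set xs \<subseteq> T \<and> P (mset xs)}"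
      using mset_eq_length[of xs ys] mset_eq_setD[of xs ys] by simp
  qed (auto simp: \<A>_def permutations_of_multiset_def)
  moreover have disjoint: "\<forall>A\<in>\<A>. \<forall>B\<in>\<A>. A \<noteq> B \<longrightarrow>
    permutations_of_multiset A \<inter> permutations_of_multiset B = {}"
    by (auto simp: permutations_of_multiset_def)
  ultimately have "card {xs. length xs = p ^ n \<and> set xs \<subseteq> T \<and> P (mset xs)} =
    (\<Sum>A\<in>\<A>. card (permutations_of_multiset A))"
    using card_UN_disjoint[OF fin, of permutations_of_multiset] disjoint by simp
  also have "\<dots> = (\<Sum>A\<in>\<A> - \<C>. card (permutations_of_multiset A)) +
    (\<Sum>A\<in>\<C>. card (permutations_of_multiset A))"
    by (rule sum.subset_diff[OF sub fin])
  also have "(\<Sum>A\<in>\<C>. card (permutations_of_multiset A)) = card \<C>"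
  proof -
    have "permutations_of_multiset (replicate_mset k t) = {replicate k t}" for k and t :: 'a
    proof (intro equalityI subsetI)
      fix xs assume "xs \<in> permutations_of_multiset (replicate_mset k t)"
      then have xs: "mset xs = replicate_mset k t"
        by (simp add: permutations_of_multiset_def)
      then have "length xs = k"
        by (metis size_mset size_replicate_mset)
      moreover have "y = t" if "y \<in> set xs" for y
        using that xs by (metis in_replicate_mset set_mset_mset)
      ultimately have "xs = replicate k t"
        by (rule replicate_eqI)
      then show "xs \<in> {replicate k t}"
        by simp
    qed (simp add: permutations_of_multiset_def)
    then have "(\<Sum>A\<in>\<C>. card (permutations_of_multiset A)) = (\<Sum>A\<in>\<C>. 1)"
      by (intro sum.cong) (auto simp: \<C>_def)
    then show ?thesis
      by simp
  qed
  also have "card \<C> = card {t \<in> T. P (replicate_mset (p ^ n) t)}"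
    unfolding \<C>_def
    by (rule card_image) (use pos in \<open>auto simp: inj_on_def replicate_mset_eq_iff\<close>)
  finally have eq: "card {xs. length xs = p ^ n \<and> set xs \<subseteq> T \<and> P (mset xs)} =
    (\<Sum>A\<in>\<A> - \<C>. card (permutations_of_multiset A)) + card {t \<in> T. P (replicate_mset (p ^ n) t)}" .
  have "p dvd card (permutations_of_multiset A)" if A: "A \<in> \<A> - \<C>" for A
  proof (rule prime_dvd_card_permutations_of_multiset[OF \<open>Factorial_Ring.prime p\<close>])
    show "size A = p ^ n"
      using A by (auto simp: \<A>_def)
    show "\<nexists>t. A = replicate_mset (p ^ n) t"
    proof
      assume "\<exists>t. A = replicate_mset (p ^ n) t"
      then obtain t where t: "A = replicate_mset (p ^ n) t"
        by blast
      obtain xs where xs: "A = mset xs" "set xs \<subseteq> T" "P (mset xs)"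
        using A unfolding \<A>_def by blast
      then have "t \<in> T"
        using t pos by (metis in_replicate_mset less_irrefl set_mset_mset subsetD)
      then show False
        using A t xs by (auto simp: \<C>_def)
    qed
  qed
  then have "p dvd (\<Sum>A\<in>\<A> - \<C>. card (permutations_of_multiset A))"
    by (rule dvd_sum)
  then show ?thesis
    unfolding eq by (auto simp: cong_def elim!: dvdE)
qed

text \<open>The Frobenius endomorphism of the group algebra of \<open>G\<close> over the field with \<open>p\<close> elements,
  read off on coefficients.\<close>
lemma (in comm_group) card_lists_product_mod_prime:
  assumes "T \<subseteq> carrier G" and "finite T" and "Factorial_Ring.prime p"
  shows "[card {xs. length xs = p ^ n \<and> set xs \<subseteq> T \<and> foldr (\<otimes>) xs \<one> = x} =
    card {t \<in> T. t [^] (p ^ n) = x}] (mod p)"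
proof -
  \<comment> \<open>The product does not depend on the order of the factors, so choosing any
    ordering turns the condition into one on multisets.\<close>
  define P where "P A \<longleftrightarrow> (\<exists>xs. mset xs = A \<and> foldr (\<otimes>) xs \<one> = x)" for A
  have P_mset: "P (mset xs) \<longleftrightarrow> foldr (\<otimes>) xs \<one> = x" if "set xs \<subseteq> T" for xs
    using that assms(1) multlist_perm_cong[of _ xs]
    unfolding P_def by (metis mset_eq_setD subset_trans)
  have fold_replicate: "foldr (\<otimes>) (replicate k t) \<one> = t [^] k" if "t \<in> T" for k t
    using that assms(1) by (induction k) (auto simp: m_comm subset_iff)
  have P_replicate: "P (replicate_mset k t) \<longleftrightarrow> t [^] k = x" if "t \<in> T" for k t
  proof -
    have "set (replicate k t) \<subseteq> T"
      using that by (auto simp: in_set_replicate)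
    then show ?thesis
      using P_mset[of "replicate k t"] fold_replicate[OF that, of k] by simp
  qed
  have "{xs. length xs = p ^ n \<and> set xs \<subseteq> T \<and> foldr (\<otimes>) xs \<one> = x} =
      {xs. length xs = p ^ n \<and> set xs \<subseteq> T \<and> P (mset xs)}"
    using P_mset by blast
  moreover have "{t \<in> T. t [^] (p ^ n) = x} = {t \<in> T. P (replicate_mset (p ^ n) t)}"
    using P_replicate by blast
  ultimately show ?thesis
    using card_lists_mod_prime[OF assms(2,3)] by simp
qed

text \<open>For a prime power k this makes the k-th powers in the Frobenius count equal to the
  elements themselves.\<close>

lemma (in group) pow_eq_self_of_cong_one:
  assumes "finite (carrier G)" and "x \<in> carrier G" and "[k = 1] (mod order G)"
  shows "x [^] (k :: nat) = x"
proof -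
  have reduce: "x [^] m = x [^] (m mod order G)" for m :: nat
  proof -
    have "x [^] m = x [^] (order G * (m div order G) + m mod order G)"
      by simp
    also have "\<dots> = x [^] (m mod order G)"
      using assms(1,2) by (simp only: nat_pow_mult[symmetric] nat_pow_pow[symmetric]) (simp add: pow_order_eq_1)
    finally show ?thesis .
  qed
  show ?thesis
    using reduce[of k] reduce[of 1] assms(2,3) by (simp add: cong_def)
qed

section \<open>Finite local rings\<close>

lemma (in group) Cauchy_prime:
  assumes fin: "finite (carrier G)" and p: "Factorial_Ring.prime p" and dvd: "p dvd order G"
  shows "\<exists>x\<in>carrier G. x \<noteq> \<one> \<and> x [^] p = \<one>"
proof -
  \<comment> \<open>With exponent 1, Sylow's theorem gives a subgroup of order p itself rather than
    a full Sylow subgroup.\<close>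
  obtain m where "order G = p ^ 1 * m"
    using dvd by auto
  then obtain H where H: "subgroup H G" "card H = p ^ 1"
    using sylow_thm[OF p group_axioms _ fin] by blast
  interpret H: group "G\<lparr>carrier := H\<rparr>"
    by (rule subgroup.subgroup_is_group[OF H(1) group_axioms])
  have "\<not> H \<subseteq> {\<one>}"
    using H(2) prime_gt_1_nat[OF p] card_mono[of "{\<one>}" H] by auto
  then obtain x where x: "x \<in> H" "x \<noteq> \<one>"
    by auto
  have "finite H"
    using H(1) fin by (meson finite_subset subgroup.subset)
  then have "x [^] p = \<one>"
    using H.pow_order_eq_1[of x] x(1) H(2) by (simp add: order_def flip: nat_pow_consistent)
  then show ?thesis
    using x subgroup.subset[OF H(1)] by blast
qed

lemma card_ZFact: "card (carrier (ZFact (int n))) = n" if "n > 0"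
proof -
  let ?n = "int n"
  have "carrier (ZFact ?n) = ZMod ?n ` UNIV"
    by (auto simp: ZFact_defs A_RCOSETS_def' ZMod_def)
  also have "\<dots> = ZMod ?n ` {0..<?n}"
  proof (intro equalityI subsetI)
    fix x assume "x \<in> ZMod ?n ` UNIV"
    then obtain a where "x = ZMod ?n a"
      by blast
    then have "x = ZMod ?n (a mod ?n)"
      by (simp add: ZMod_mod[of ?n a])
    then show "x \<in> ZMod ?n ` {0..<?n}"
      using that by simp
  qed auto
  also have "card \<dots> = n"
    by (subst card_image) (auto simp: inj_on_def ZMod_eq_mod)
  finally show ?thesis .
qed

text \<open>The canonical map from the integers has kernel generated by the additive order of
  \<open>\<one>\<close>, which divides p and is not 1. Its image thus has p elements and is all of
  R.\<close>

lemma (in cring) iso_ZFact_of_card_prime: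
  assumes card: "card (carrier R) = p" and p: "Factorial_Ring.prime p"
  shows "R \<simeq> ZFact (int p)"
proof -
  let ?f = "\<lambda>n :: int. [n] \<cdot> \<one>"
  have fin: "finite (carrier R)"
    using card prime_gt_0_nat[OF p] card_gt_0_iff by metis
  have ne: "\<one> \<noteq> \<zero>"
  proof
    assume "\<one> = \<zero>"
    then have "carrier R = {\<zero>}"
      using one_zeroD by simp
    then show False
      using card prime_gt_1_nat[OF p] by simp
  qed
  have hom: "?f \<in> ring_hom \<Z> R"
    by (rule ring_hom_memI)
      (auto simp: add.int_pow_mult add_pow_ldistr_int add.int_pow_pow mult.commute add.int_pow_1)
  interpret f: ring_hom_ring \<Z> R ?f
    by (rule ring_hom_ring.intro) (auto simp: ring_hom_ring_axioms_def hom int.ring_axioms ring_axioms)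
  have ord_dvd: "add.ord \<one> dvd p"
    using add.ord_dvd_group_order[of \<one>] card by (simp add: order_def)
  moreover have "add.ord \<one> \<noteq> 1"
    using add.ord_eq_1[of \<one>] ne by simp
  ultimately have ord: "add.ord \<one> = p"
    using p by (auto simp: prime_nat_iff)
  have "a_kernel \<Z> R ?f = Idl\<^bsub>\<Z>\<^esub> {int p}"
  proof -
    have "a_kernel \<Z> R ?f = {n. int p dvd n}"
      using add.int_pow_eq_id[OF one_closed] unfolding ord by (simp only: a_kernel_def' int_carrier_eq) simp
    also have "\<dots> = Idl\<^bsub>\<Z>\<^esub> {int p}"
      unfolding int_Idl by (metis (no_types) dvd_def mult.commute)
    finally show ?thesis .
  qed
  then have ker: "\<Z> Quot a_kernel \<Z> R ?f = ZFact (int p)"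
    by (simp add: ZFact_def)
  have "range ?f = carrier R"
  proof (rule card_subset_eq[OF fin])
    show sub: "range ?f \<subseteq> carrier R"
      by auto
    have "card (carrier (ZFact (int p))) = card (range ?f)"
      using f.FactRing_iso_set_aux unfolding ker ring_iso_def by (auto dest: bij_betw_same_card)
    then show "card (range ?f) = card (carrier R)"
      using card_ZFact[OF prime_gt_0_nat[OF p]] card by simp
  qed
  from f.FactRing_iso[OF this] have "ZFact (int p) \<simeq> R"
    by (simp add: ker)
  then show ?thesis
    using ring_iso_sym[OF cring.axioms(1)[OF ZFact_is_cring]] by blast
qed

lemma (in cring) signed_unit_squares_subset_Units: "signed_unit_squares R \<subseteq> Units R"
proof -
  have sq: "u [^] (2::nat) \<in> Units R" if "u \<in> Units R" for u
    using that Units_pow_closed by blast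
  have "\<ominus> x \<in> Units R" if "x \<in> Units R" for x
    using that Units_minus_one_closed Units_m_closed[of "\<ominus> \<one>" x] by (simp add: l_minus Units_closed)
  with sq show ?thesis
    by (auto simp: signed_unit_squares_def unit_squares_def)
qed

lemma (in cring) one_in_signed_unit_squares: "\<one> \<in> signed_unit_squares R"
  by (auto simp: signed_unit_squares_def unit_squares_def intro!: exI[of _ \<one>])

section \<open>Residue field, units and square roots of one in a finite local ring\<close>

locale finite_local_ring = cring R for R :: "('a, 'm) ring_scheme" (structure) +
  fixes M :: "'a set" and q :: nat
  assumes finite_carrier: "finite (carrier R)"
    and local: "local_ring R"
    and maximal: "maximalideal M R"
    and residue_card: "card (carrier R) div card M = q"
begin

sublocale M: maximalideal M R
  by (rule maximal)

lemma one_notin_M: "\<one> \<notin> M"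
  using M.I_notcarr M.one_imp_carrier by blast

text \<open>A nonunit generates a proper ideal. By finiteness this lies in a maximal ideal, which is
  M because the ring is local.\<close>

lemma Units_eq: "Units R = carrier R - M"
proof (intro equalityI subsetI DiffI)
  fix x assume x: "x \<in> Units R"
  show "x \<in> carrier R"
    using x by (rule Units_closed)
  show "x \<notin> M"
  proof
    assume "x \<in> M"
    then have "inv x \<otimes> x \<in> M"
      using x by (intro M.I_l_closed) auto
    then show False
      using x one_notin_M by simp
  qed
next
  fix x assume x: "x \<in> carrier R - M"
  show "x \<in> Units R"
  proof (rule ccontr)
    assume nonunit: "x \<notin> Units R"
    define S where "S = {I. ideal I R \<and> x \<in> I \<and> \<one> \<notin> I}"
    have "\<one> \<notin> PIdl x"
      using nonunit x m_comm by (auto simp: cgenideal_def Units_def)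
    then have "PIdl x \<in> S"
      using x by (simp add: S_def cgenideal_ideal cgenideal_self)
    moreover have "finite S"
      using finite_carrier
      by (rule finite_subset[rotated, OF finite_Pow_iff[THEN iffD2]])
        (auto simp: S_def dest: additive_subgroup.a_subset ideal.axioms(1))
    ultimately obtain I where I: "I \<in> S" and max: "\<And>J. J \<in> S \<Longrightarrow> I \<subseteq> J \<Longrightarrow> I = J"
      using finite_has_maximal[of S] by blast
    have "maximalideal I R"
    proof (rule maximalidealI)
      show "ideal I R" "carrier R \<noteq> I"
        using I by (auto simp: S_def)
      fix J assume J: "ideal J R" "I \<subseteq> J"
      show "J = I \<or> J = carrier R"
        using max[of J] J I ideal.one_imp_carrier[OF J(1)] by (auto simp: S_def)
    qed
    then have "I = M"
      using local maximal by (auto simp: local_ring_def)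
    then show False
      using I x by (auto simp: S_def)
  qed
qed

lemma zero_in_M: "\<zero> \<in> M"
  by (rule additive_subgroup.zero_closed[OF M.is_additive_subgroup])

lemma one_neq_zero: "\<one> \<noteq> \<zero>"
  using one_notin_M zero_in_M by auto

lemma M_subset: "M \<subseteq> carrier R"
  by (rule M.a_subset)

lemma finite_M: "finite M"
  using M_subset finite_carrier by (rule finite_subset)

lemma card_M_pos: "0 < card M"
  using finite_M zero_in_M by (metis card_gt_0_iff empty_iff)

text \<open>Lagrange's theorem for the cosets of M shows that the integer division defining q is
  exact, so q is the order of the residue field.\<close>

lemma card_quotient: "card (carrier (R Quot M)) = q"
  and card_carrier: "card (carrier R) = q * card M"
proof -
  have eq: "card (a_rcosets M) * card M = card (carrier R)"
    using a_lagrange[OF finite_carrier M.additive_subgroup_axioms] by (simp add: order_def)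
  then have "card (a_rcosets M) = q"
    using card_M_pos residue_card by (metis nonzero_mult_div_cancel_right less_irrefl)
  then show "card (carrier (R Quot M)) = q" "card (carrier R) = q * card M"
    using eq by (simp_all add: FactRing_def)
qed

lemma card_Units: "card (Units R) = (q - 1) * card M"
  unfolding Units_eq
  by (simp add: card_Diff_subset finite_M M_subset card_carrier diff_mult_distrib)

text \<open>In the residue field, one has additive order p, and this order divides q.\<close>

lemma prime_dvd_residue_card_of_mem:
  assumes p: "Factorial_Ring.prime p" and p1: "[p] \<cdot> \<one> \<in> M"
  shows "p dvd q"
proof -
  let ?Q = "R Quot M"
  have zero: "\<zero>\<^bsub>?Q\<^esub> = M" and one: "\<one>\<^bsub>?Q\<^esub> = M +> \<one>"
    by (simp_all add: FactRing_def)
  interpret Q: ring ?Q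
    by (rule M.quotient_is_ring)
  interpret h: ring_hom_ring R ?Q "(+>) M"
    by (rule M.rcos_ring_hom_ring)
  have "[k] \<cdot>\<^bsub>?Q\<^esub> \<one>\<^bsub>?Q\<^esub> = M +> ([k] \<cdot> \<one>)" for k :: nat
    by (induction k) simp_all
  from this[of p] have "[p] \<cdot>\<^bsub>?Q\<^esub> \<one>\<^bsub>?Q\<^esub> = \<zero>\<^bsub>?Q\<^esub>"
    unfolding a_rcos_zero[OF M.is_ideal p1] zero .
  then have "Q.add.ord \<one>\<^bsub>?Q\<^esub> dvd p"
    using Q.add.pow_eq_id[of "\<one>\<^bsub>?Q\<^esub>" p] by simp
  moreover have "\<one>\<^bsub>?Q\<^esub> \<noteq> \<zero>\<^bsub>?Q\<^esub>"
    using one_notin_M ideal.rcos_const_imp_mem[OF M.is_ideal one_closed] unfolding zero one by blast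
  then have "Q.add.ord \<one>\<^bsub>?Q\<^esub> \<noteq> 1"
    using Q.add.ord_eq_1[of "\<one>\<^bsub>?Q\<^esub>"] by simp
  ultimately have "Q.add.ord \<one>\<^bsub>?Q\<^esub> = p"
    using p by (auto simp: prime_nat_iff)
  then show ?thesis
    using Q.add.ord_dvd_group_order[of "\<one>\<^bsub>?Q\<^esub>"] by (simp add: order_def card_quotient)
qed

text \<open>Cauchy's theorem gives x \<noteq> 0 with p x = 0. Hence p times one annihilates x, is
  not a unit, and lies in M.\<close>

lemma prime_dvd_residue_card:
  assumes p: "Factorial_Ring.prime p" and dvd: "p dvd card (carrier R)"
  shows "p dvd q"
proof -
  obtain x where x: "x \<in> carrier R" "x \<noteq> \<zero>" "[p] \<cdot> x = \<zero>"
    using add.Cauchy_prime[of p] finite_carrier p dvd by (auto simp: order_def)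
  have "([p] \<cdot> \<one>) \<otimes> x = \<zero>"
    using x by (simp add: add_pow_ldistr)
  then have "[p] \<cdot> \<one> \<notin> Units R"
    using x by (metis Units_l_cancel r_null zero_closed Units_closed)
  then show ?thesis
    by (intro prime_dvd_residue_card_of_mem[OF p]) (simp add: Units_eq)
qed

lemma odd_card_carrier: "odd (card (carrier R))" if "odd q"
  using prime_dvd_residue_card[of 2] that by auto

lemma odd_card_M: "odd (card M)" if "odd q"
  using odd_card_carrier[OF that] by (simp add: card_carrier)

lemma two_in_Units: "\<one> \<oplus> \<one> \<in> Units R" if "odd q"
proof -
  have "add_pow R (2 :: nat) \<one> = \<one> \<oplus> \<one>"
    by (simp add: numeral_2_eq_2)
  then show ?thesis
    using prime_dvd_residue_card_of_mem[of 2] that by (auto simp: Units_eq)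
qed

text \<open>In (u - 1) (u + 1) = 0 one factor is a unit, and the other then vanishes. Otherwise both
  lie in M, and so does their difference 2, which is a unit for odd q.\<close>

lemma square_eq_one:
  assumes "odd q" and u: "u \<in> carrier R" and sq: "u \<otimes> u = \<one>"
  shows "u = \<one> \<or> u = \<ominus> \<one>"
proof -
  have prod: "(u \<ominus> \<one>) \<otimes> (u \<oplus> \<one>) = \<zero>"
  proof -
    have "(u \<ominus> \<one>) \<otimes> (u \<oplus> \<one>) = u \<otimes> u \<ominus> \<one>"
      using u by algebra
    then show ?thesis
      by (simp add: sq)
  qed
  consider "u \<ominus> \<one> \<in> Units R" | "u \<oplus> \<one> \<in> Units R" | "u \<ominus> \<one> \<in> M" "u \<oplus> \<one> \<in> M"
    using u by (auto simp: Units_eq)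
  then show ?thesis
  proof cases
    case 1
    then have "u \<oplus> \<one> = \<zero>"
      using prod u by (metis Units_l_cancel a_closed one_closed r_null zero_closed Units_closed)
    then show ?thesis
      using u by (simp add: add.inv_equality minus_equality)
  next
    case 2
    then have "u \<ominus> \<one> = \<zero>"
      using prod u m_comm by (metis Units_l_cancel minus_closed one_closed r_null zero_closed Units_closed)
    then show ?thesis
      using u by simp
  next
    case 3
    then have "\<one> \<oplus> \<one> \<in> M"
    proof -
      have "(u \<oplus> \<one>) \<oplus> (\<ominus> \<one> \<otimes> (u \<ominus> \<one>)) \<in> M"
        by (rule additive_subgroup.a_closed[OF M.is_additive_subgroup 3(2) M.I_l_closed[OF 3(1)]]) simp
      moreover have "(u \<oplus> \<one>) \<oplus> (\<ominus> \<one> \<otimes> (u \<ominus> \<one>)) = \<one> \<oplus> \<one>"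
        using u by algebra
      ultimately show ?thesis
        by (simp only:)
    qed
    then show ?thesis
      using two_in_Units[OF \<open>odd q\<close>] by (simp add: Units_eq)
  qed
qed

lemma one_neq_minus_one: "\<one> \<noteq> \<ominus> \<one>" if "odd q"
proof
  assume "\<one> = \<ominus> \<one>"
  then have "\<one> \<oplus> \<one> = \<zero>"
    using r_neg[of \<one>] by simp
  then show False
    using two_in_Units[OF that] zero_in_M by (simp add: Units_eq)
qed

text \<open>The unit group has order 2 r with r odd. So v^r is 1 or -1, and v equals v^(r+1) up to
  sign, where r + 1 is even.\<close>

lemma signed_unit_squares_eq_Units:
  assumes "q mod 4 = 3"
  shows "signed_unit_squares R = Units R"
proof
  show "signed_unit_squares R \<subseteq> Units R"
    by (rule signed_unit_squares_subset_Units)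
  have "odd q"
    using assms by presburger
  obtain r where r: "(q - 1) * card M = 2 * r" "odd r"
  proof
    have "q - 1 = 2 * ((q - 1) div 2)" "odd ((q - 1) div 2)"
      using assms by presburger+
    then show "(q - 1) * card M = 2 * ((q - 1) div 2 * card M)" "odd ((q - 1) div 2 * card M)"
      using odd_card_M[OF \<open>odd q\<close>] by (simp_all add: mult.assoc)
  qed
  interpret U: group "units_of R"
    by (rule units_group)
  show "Units R \<subseteq> signed_unit_squares R"
  proof
    fix v assume v: "v \<in> Units R"
    then have vc: "v \<in> carrier R"
      by (rule Units_closed)
    have "v [^]\<^bsub>units_of R\<^esub> (2 * r) = \<one>"
      using U.pow_order_eq_1[of v] v r card_Units
      by (simp add: order_def units_of_carrier units_of_one)
    then have "v [^] (2 * r) = \<one>"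
      using units_of_pow[OF v] by simp
    then have "(v [^] r) \<otimes> (v [^] r) = \<one>"
      using vc by (simp add: nat_pow_mult mult_2)
    then have "v [^] r = \<one> \<or> v [^] r = \<ominus> \<one>"
      using square_eq_one[OF \<open>odd q\<close>] vc by simp
    moreover have "v [^] r \<otimes> v = (v [^] ((r + 1) div 2)) [^] (2 :: nat)"
    proof -
      have "(r + 1) div 2 * 2 = Suc r"
        using r(2) by presburger
      then show ?thesis
        using vc by (simp add: nat_pow_pow)
    qed
    moreover have "v [^] ((r + 1) div 2) \<in> Units R"
      using v by (rule Units_pow_closed)
    moreover have "v = \<ominus> (\<ominus> \<one> \<otimes> v)"
      using vc by (simp add: l_minus)
    ultimately show "v \<in> signed_unit_squares R"
      using vc unfolding signed_unit_squares_def unit_squares_def by auto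
  qed
qed

text \<open>As 4 divides the order of the unit group, there is a subgroup of order 4. It contains
  some u other than 1 and -1; then u^4 = 1, and u^2 = 1 is excluded by
  \<open>square_eq_one\<close>.\<close>

lemma minus_one_square:
  assumes "q mod 4 = 1"
  obtains i where "i \<in> carrier R" "i \<otimes> i = \<ominus> \<one>"
proof -
  have "odd q"
    using assms by presburger
  interpret U: group "units_of R"
    by (rule units_group)
  have fin: "finite (carrier (units_of R))"
    using finite_carrier by (simp add: units_of_carrier Units_eq)
  have "4 dvd q - 1"
    using assms by presburger
  then obtain m where "order (units_of R) = 2 ^ 2 * m"
    by (auto simp: order_def units_of_carrier card_Units)
  then obtain H where H: "subgroup H (units_of R)" "card H = 2 ^ 2"
    using sylow_thm[OF two_is_prime_nat U.group_axioms _ fin] by blast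
  have "\<not> H \<subseteq> {\<one>, \<ominus> \<one>}"
    using H(2) card_mono[of "{\<one>, \<ominus> \<one>}" H] card_insert_le_m1[of 2 "{\<ominus> \<one>}" \<one>] by auto
  then obtain u where u: "u \<in> H" "u \<noteq> \<one>" "u \<noteq> \<ominus> \<one>"
    by auto
  interpret H: group "units_of R\<lparr>carrier := H\<rparr>"
    by (rule subgroup.subgroup_is_group[OF H(1) U.group_axioms])
  have unit: "u \<in> Units R"
    using subgroup.subset[OF H(1)] u(1) by (auto simp: units_of_carrier)
  then have uc: "u \<in> carrier R"
    by (rule Units_closed)
  have "u [^]\<^bsub>units_of R\<^esub> (4 :: nat) = \<one>"
    using H.pow_order_eq_1[of u] u(1) H(2)
    by (simp add: order_def units_of_one flip: U.nat_pow_consistent)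
  then have "u [^] (4 :: nat) = \<one>"
    using units_of_pow[OF unit] by simp
  then have "(u \<otimes> u) \<otimes> (u \<otimes> u) = \<one>"
    using uc by (simp add: numeral_eq_Suc m_assoc)
  then have "u \<otimes> u = \<one> \<or> u \<otimes> u = \<ominus> \<one>"
    using square_eq_one[OF \<open>odd q\<close>] uc by simp
  moreover have "u \<otimes> u \<noteq> \<one>"
    using square_eq_one[OF \<open>odd q\<close> uc] u by blast
  ultimately show thesis
    using that uc by blast
qed

end

text \<open>The signed squares form a group under multiplication, and 1, e, -1, -e form a Klein
  four-group inside it; Lagrange's theorem applies.\<close>

lemma (in cring) four_dvd_card_signed_unit_squares:
  assumes fin: "finite (carrier R)" and e: "e \<in> unit_squares R" "e \<otimes> e = \<one>"
    and ne: "e \<noteq> \<one>" "e \<noteq> \<ominus> \<one>" "\<one> \<noteq> \<ominus> \<one>"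
  shows "4 dvd card (signed_unit_squares R)"
proof -
  let ?T = "signed_unit_squares R" and ?H = "{\<one>, e, \<ominus> \<one>, \<ominus> e}"
  interpret U: group "units_of R"
    by (rule units_group)
  have ec: "e \<in> carrier R"
    using e(1) by (auto simp: unit_squares_def)
  have "u [^] (2::nat) = u \<otimes> u" if "u \<in> Units R" for u
    using that by (simp add: numeral_2_eq_2 Units_closed)
  then have squares: "unit_squares R = (\<lambda>u. u \<otimes> u) ` Units R"
    by (simp add: unit_squares_def setcompr_eq_image cong: image_cong)
  have T_iff: "x \<in> ?T \<longleftrightarrow> (\<exists>u\<in>Units R. x = u \<otimes> u \<or> x = \<ominus> (u \<otimes> u))" for x
    by (auto simp: signed_unit_squares_def squares)
  have T: "subgroup ?T (units_of R)"
  proof (rule U.subgroupI)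
    show "?T \<subseteq> carrier (units_of R)" "?T \<noteq> {}"
      using signed_unit_squares_subset_Units one_in_signed_unit_squares
      by (auto simp: units_of_carrier)
    fix x assume "x \<in> ?T"
    then obtain u where u: "u \<in> Units R" "x = u \<otimes> u \<or> x = \<ominus> (u \<otimes> u)"
      by (auto simp: T_iff)
    have uc: "u \<in> carrier R" "inv u \<in> carrier R" "u \<otimes> inv u = \<one>"
      using u by auto
    {
      have "(u \<otimes> u) \<otimes> (inv u \<otimes> inv u) = (u \<otimes> inv u) \<otimes> (u \<otimes> inv u)"
        using uc(1,2) by algebra
      then have "(u \<otimes> u) \<otimes> (inv u \<otimes> inv u) = \<one>"
        using uc by simp
      then have "inv x = inv u \<otimes> inv u \<or> inv x = \<ominus> (inv u \<otimes> inv u)"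
        using u(2) uc by (auto intro!: comm_inv_char simp: l_minus r_minus)
    }
    then have "inv x \<in> ?T"
      using u(1) T_iff by blast
    then show "inv\<^bsub>units_of R\<^esub> x \<in> ?T"
      using units_of_inv[of x] \<open>x \<in> ?T\<close> signed_unit_squares_subset_Units by auto
    fix y assume "y \<in> ?T"
    then obtain v where v: "v \<in> Units R" "y = v \<otimes> v \<or> y = \<ominus> (v \<otimes> v)"
      by (auto simp: T_iff)
    have vc: "v \<in> carrier R"
      using v by auto
    have "(u \<otimes> u) \<otimes> (v \<otimes> v) = (u \<otimes> v) \<otimes> (u \<otimes> v)"
      using uc(1) vc by algebra
    then have "x \<otimes> y = (u \<otimes> v) \<otimes> (u \<otimes> v) \<or> x \<otimes> y = \<ominus> ((u \<otimes> v) \<otimes> (u \<otimes> v))"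
      using u(2) v(2) uc vc by (auto simp: l_minus r_minus)
    then show "x \<otimes>\<^bsub>units_of R\<^esub> y \<in> ?T"
      using u(1) v(1) T_iff by (auto simp: units_of_mult)
  qed
  interpret T: group "units_of R\<lparr>carrier := ?T\<rparr>"
    by (rule subgroup.subgroup_is_group[OF T U.group_axioms])
  have finT: "finite ?T"
    using fin signed_unit_squares_subset_Units Units_closed by (meson finite_subset subsetI subset_trans)
  have eT: "e \<in> ?T"
    using e(1) by (simp add: signed_unit_squares_def)
  have sub: "?H \<subseteq> ?T"
    using eT one_in_signed_unit_squares signed_unit_squares_uminus by auto
  have closed: "x \<otimes> y \<in> ?H" if "x \<in> ?H" "y \<in> ?H" for x y
    using that ec e(2) by (auto simp: l_minus r_minus)
  have self_inv: "x \<otimes> x = \<one>" if "x \<in> ?H" for x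
    using that ec e(2) by (auto simp: l_minus r_minus)
  have "subgroup ?H (units_of R\<lparr>carrier := ?T\<rparr>)"
  proof (rule T.subgroupI)
    fix x assume x: "x \<in> ?H"
    have "inv\<^bsub>units_of R\<lparr>carrier := ?T\<rparr>\<^esub> x = x"
      using self_inv[OF x] x sub by (intro T.inv_equality) (auto simp: units_of_def)
    then show "inv\<^bsub>units_of R\<lparr>carrier := ?T\<rparr>\<^esub> x \<in> ?H"
      using x by simp
    fix y assume "y \<in> ?H"
    then show "x \<otimes>\<^bsub>units_of R\<lparr>carrier := ?T\<rparr>\<^esub> y \<in> ?H"
      using closed x by (simp add: units_of_def)
  qed (use sub in auto)
  note lagrange = T.lagrange[OF this]
  have "order (units_of R\<lparr>carrier := ?T\<rparr>) = card ?T"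
    by (simp add: order_def)
  with lagrange have "card ?H dvd card ?T"
    by (metis dvd_triv_right)
  moreover have "card ?H = 4"
  proof -
    have "\<ominus> \<one> \<noteq> \<ominus> e" "\<one> \<noteq> \<ominus> e" "e \<noteq> \<ominus> e"
    proof -
      show "\<ominus> \<one> \<noteq> \<ominus> e" "\<one> \<noteq> \<ominus> e"
        using ne ec by (metis minus_minus one_closed)+
      show "e \<noteq> \<ominus> e"
      proof
        assume "e = \<ominus> e"
        moreover have "\<ominus> e \<otimes> e = \<ominus> \<one>"
          using ec e(2) by (simp add: l_minus)
        ultimately show False
          using e(2) ne(3) by metis
      qed
    qed
    then show ?thesis
      using ne by (auto simp: card_insert_if)
  qed
  ultimately show ?thesis
    by simp
qed

section \<open>Quadratic unitary Cayley graphs\<close>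

lemma (in cring) neighbours_quadratic_unitary_cayley_graph:
  assumes "\<one> \<noteq> \<zero>" and u: "u \<in> carrier R"
  shows "{v. (u, v) \<in> parcs (quadratic_unitary_cayley_graph R)} =
    (\<lambda>t. u \<ominus> t) ` signed_unit_squares R"
    and "inj_on (\<lambda>t. u \<ominus> t) (signed_unit_squares R)"
proof -
  let ?T = "signed_unit_squares R"
  \<comment> \<open>Zero is not a unit, so the requirement that adjacent vertices differ holds by
    itself.\<close>
  have T: "?T \<subseteq> carrier R" "\<zero> \<notin> ?T"
    using signed_unit_squares_subset_Units assms(1) by (auto simp: Units_def)
  have diff: "u \<ominus> (u \<ominus> t) = t" if "t \<in> carrier R" for t
    using u that by algebra
  show "inj_on (\<lambda>t. u \<ominus> t) ?T"
    by (rule inj_on_inverseI[where g = "\<lambda>v. u \<ominus> v"]) (use T diff in auto)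
  show "{v. (u, v) \<in> parcs (quadratic_unitary_cayley_graph R)} = (\<lambda>t. u \<ominus> t) ` ?T"
  proof (intro equalityI subsetI)
    fix v assume "v \<in> {v. (u, v) \<in> parcs (quadratic_unitary_cayley_graph R)}"
    then have "v \<in> carrier R" "u \<ominus> v \<in> ?T"
      by (auto simp: quadratic_unitary_cayley_graph_def cayley_graph_def)
    then show "v \<in> (\<lambda>t. u \<ominus> t) ` ?T"
      using diff by (intro image_eqI[of _ _ "u \<ominus> v"]) simp_all
  next
    fix v assume "v \<in> (\<lambda>t. u \<ominus> t) ` ?T"
    then obtain t where t: "t \<in> ?T" "t \<in> carrier R" "v = u \<ominus> t"
      using T by auto
    moreover have "u \<noteq> u \<ominus> t"
      using diff[OF t(2)] t T u by (metis a_minus_def r_neg)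
    ultimately show "v \<in> {v. (u, v) \<in> parcs (quadratic_unitary_cayley_graph R)}"
      using u diff by (auto simp: quadratic_unitary_cayley_graph_def cayley_graph_def)
  qed
qed

lemma (in cring) regular_graph_quadratic_unitary_cayley_graph:
  assumes fin: "finite (carrier R)" and one: "\<one> \<noteq> \<zero>"
  shows "regular_graph (quadratic_unitary_cayley_graph R) (card (signed_unit_squares R))"
proof -
  interpret pair_graph "quadratic_unitary_cayley_graph R"
    by (rule pair_graph_quadratic_unitary_cayley_graph[OF fin])
  have "finite (signed_unit_squares R)"
    using signed_unit_squares_subset_Units fin
    by (metis Units_closed finite_subset subsetI subset_trans)
  then have pos: "0 < card (signed_unit_squares R)"
    using one_in_signed_unit_squares by (auto simp: card_gt_0_iff)
  have "u \<in> carrier R" if "u \<in> pverts (quadratic_unitary_cayley_graph R)" for u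
    using that by (simp add: quadratic_unitary_cayley_graph_def cayley_graph_def)
  with pos show ?thesis
    by unfold_locales (simp_all add: neighbours_quadratic_unitary_cayley_graph[OF one] card_image)
qed

text \<open>A walk of length n between zero and u is a word of n elements of T with sum u; each edge
  carries the weight 2 / |T|.\<close>

lemma (in cring) step_pow_indicator:
  assumes fin: "finite (carrier R)" and one: "\<one> \<noteq> \<zero>" and u: "u \<in> carrier R"
  defines "T \<equiv> signed_unit_squares R"
  shows "(regular_graph.step (quadratic_unitary_cayley_graph R) (card T) ^^ n)
      (\<lambda>v. if v = \<zero> then 1 else 0) u =
    (2 / of_nat (card T)) ^ n *
      of_nat (card {xs. length xs = n \<and> set xs \<subseteq> T \<and> foldr (\<oplus>) xs \<zero> = u})"
proof -
  let ?G = "quadratic_unitary_cayley_graph R"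
  let ?L = "\<lambda>n u. {xs. length xs = n \<and> set xs \<subseteq> T \<and> foldr (\<oplus>) xs \<zero> = u}"
  interpret regular_graph ?G "card T"
    unfolding T_def by (rule regular_graph_quadratic_unitary_cayley_graph[OF fin one])
  have T: "T \<subseteq> carrier R"
    unfolding T_def using signed_unit_squares_subset_Units Units_closed by blast
  have finT: "finite T"
    using T fin by (rule finite_subset)
  have finL: "finite (?L n u)" for n u
    by (rule finite_subset[OF _ finite_lists_length_eq[OF finT, of n]]) auto
  show ?thesis
    using u
  proof (induction n arbitrary: u)
    case 0
    have "?L 0 u = (if u = \<zero> then {[]} else {})"
      by auto
    then show ?case
      by simp
  next
    case (Suc n)
    have foldr_closed: "foldr (\<oplus>) xs \<zero> \<in> carrier R" if "set xs \<subseteq> T" for xs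
      using that T by (induction xs) auto
    \<comment> \<open>Words are split by their first letter, which corresponds to the first edge at
      u.\<close>
    have "?L (Suc n) u = (\<Union>t\<in>T. Cons t ` ?L n (u \<ominus> t))"
    proof (intro equalityI subsetI)
      fix ys assume "ys \<in> ?L (Suc n) u"
      then obtain t xs where ys: "ys = t # xs" "t \<in> T" "set xs \<subseteq> T" "length xs = n"
        "t \<oplus> foldr (\<oplus>) xs \<zero> = u"
        by (auto simp: length_Suc_conv)
      moreover have "x = (t \<oplus> x) \<ominus> t" if "t \<in> carrier R" "x \<in> carrier R" for t x
        using that by algebra
      ultimately have "foldr (\<oplus>) xs \<zero> = u \<ominus> t"
        using T foldr_closed[OF ys(3)] by blast
      with ys show "ys \<in> (\<Union>t\<in>T. Cons t ` ?L n (u \<ominus> t))"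
        by auto
    next
      fix ys assume "ys \<in> (\<Union>t\<in>T. Cons t ` ?L n (u \<ominus> t))"
      then obtain t xs where ys: "ys = t # xs" "t \<in> T" "set xs \<subseteq> T" "length xs = n"
        "foldr (\<oplus>) xs \<zero> = u \<ominus> t"
        by auto
      moreover have "t \<in> carrier R"
        using T ys(2) by blast
      then have "t \<oplus> (u \<ominus> t) = u"
        using Suc.prems by algebra
      ultimately show "ys \<in> ?L (Suc n) u"
        by simp
    qed
    moreover have "card (\<Union>t\<in>T. Cons t ` ?L n (u \<ominus> t)) = (\<Sum>t\<in>T. card (Cons t ` ?L n (u \<ominus> t)))"
      by (rule card_UN_disjoint) (use finT finL in auto)
    ultimately have "card (?L (Suc n) u) = (\<Sum>t\<in>T. card (Cons t ` ?L n (u \<ominus> t)))"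
      by (simp only:)
    also have "\<dots> = (\<Sum>t\<in>T. card (?L n (u \<ominus> t)))"
      by (simp add: card_image)
    finally have card_L: "card (?L (Suc n) u) = (\<Sum>t\<in>T. card (?L n (u \<ominus> t)))" .
    have "(step ^^ Suc n) (\<lambda>v. if v = \<zero> then 1 else 0) u =
      2 / of_nat (card T) * (\<Sum>t\<in>T. (step ^^ n) (\<lambda>v. if v = \<zero> then 1 else 0) (u \<ominus> t))"
      using neighbours_quadratic_unitary_cayley_graph[OF one Suc.prems, folded T_def]
      by (simp add: step_def sum.reindex)
    also have "\<dots> = 2 / of_nat (card T) * (\<Sum>t\<in>T. (2 / of_nat (card T)) ^ n * of_nat (card (?L n (u \<ominus> t))))"
      using Suc.IH Suc.prems T by (intro arg_cong2[where f = "(*)"] sum.cong refl) auto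
    also have "\<dots> = (2 / of_nat (card T)) ^ Suc n * of_nat (card (?L (Suc n) u))"
      unfolding card_L by (simp add: sum_distrib_left mult.assoc)
    finally show ?case .
  qed
qed

text \<open>If |T| = 2 p c, the n-th power of 2 / |T| brings the denominator (p c)^n, while
  periodicity bounds denominators by |T|^\<tau>. A walk count prime to p cannot cancel p^n, so p^n
  divides |T|^\<tau>, which fails for large n.\<close>

theorem (in cring) grover_periodic_imp_not_dvd:
  assumes fin: "finite (carrier R)" and one: "\<one> \<noteq> \<zero>"
    and "Factorial_Ring.prime p" and p: "\<not> p dvd card (carrier R)"
    and periodic: "grover_periodic (quadratic_unitary_cayley_graph R)"
  shows "\<not> 2 * p dvd card (signed_unit_squares R)"
proof
  let ?G = "quadratic_unitary_cayley_graph R"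
  define T where "T = signed_unit_squares R"
  assume "2 * p dvd card (signed_unit_squares R)"
  then obtain c where c: "card T = 2 * p * c"
    by (auto simp: T_def)
  interpret regular_graph ?G "card T"
    unfolding T_def by (rule regular_graph_quadratic_unitary_cayley_graph[OF fin one])
  have T: "T \<subseteq> carrier R"
    unfolding T_def using signed_unit_squares_subset_Units Units_closed by blast
  have finT: "finite T"
    using T fin by (rule finite_subset)
  obtain \<tau> where \<tau>: "\<tau> > 0" "\<And>\<phi> a. a \<in> parcs ?G \<Longrightarrow> (grover ^^ \<tau>) \<phi> a = \<phi> a"
    using periodic unfolding grover_periodic_iff by blast

  \<comment> \<open>The totient factor gives n = 1 modulo |R| by Euler's theorem. The factor
    |T|^\<tau> makes n large enough: |T|^\<tau> \<le> a < n < p^n.\<close>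
  define a where "a = totient (card (carrier R)) * card T ^ \<tau>"
  define n where "n = p ^ a"
  define W where "W = card {xs. length xs = n \<and> set xs \<subseteq> T \<and> foldr (\<oplus>) xs \<zero> = \<one>}"
  have "coprime p (card (carrier R))"
    using assms(3) p by (simp add: prime_imp_coprime)
  then have "[p ^ totient (card (carrier R)) = 1] (mod card (carrier R))"
    by (rule euler_theorem)
  from cong_pow[OF this, of "card T ^ \<tau>"]
  have "[n = 1] (mod order (add_monoid R))"
    by (simp add: n_def a_def power_mult order_def)
  then have "t [^]\<^bsub>add_monoid R\<^esub> n = t" if "t \<in> T" for t
    using group.pow_eq_self_of_cong_one[OF a_group, of t n] that T fin by auto
  \<comment> \<open>Multiplication by n fixes T, so only the ring's \<open>\<one>\<close> is
    counted, which is not the neutral element of \<open>add_monoid R\<close>.\<close>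
  then have "{t \<in> T. t [^]\<^bsub>add_monoid R\<^esub> n = \<one>} = {\<one>}"
    using one_in_signed_unit_squares by (auto simp: T_def)
  moreover have "[W = card {t \<in> T. t [^]\<^bsub>add_monoid R\<^esub> n = \<one>}] (mod p)"
    using comm_group.card_lists_product_mod_prime[OF a_comm_group, of T p a \<one>] T finT assms(3)
    by (simp add: W_def n_def)
  ultimately have "[W = 1] (mod p)"
    by simp
  then have "coprime p W"
    by (metis cong_imp_coprime cong_sym coprime_1_right coprime_commute)
  then have cop: "coprime (p ^ n) W"
    by simp

  have "of_nat (card T) ^ \<tau> * (step ^^ n) (\<lambda>v. if v = \<zero> then 1 else 0) \<one> \<in> \<int>"
    by (rule step_pow_bounded_denominator[OF \<tau>])
      (auto simp: quadratic_unitary_cayley_graph_def cayley_graph_def)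
  then have "of_nat (card T) ^ \<tau> * ((2 / of_nat (card T)) ^ n * of_nat W) \<in> (\<int> :: complex set)"
    using step_pow_indicator[OF fin one one_closed, of n] by (simp add: T_def W_def)
  moreover have "(2 / of_nat (card T)) ^ n = (1 / of_nat ((p * c) ^ n) :: complex)"
    by (simp add: c power_divide power_mult_distrib field_simps)
  ultimately have "of_nat (card T ^ \<tau> * W) / of_nat ((p * c) ^ n) \<in> (\<int> :: complex set)"
    by simp
  then obtain z where z: "of_nat (card T ^ \<tau> * W) / of_nat ((p * c) ^ n) = (of_int z :: complex)"
    by (elim Ints_cases)
  have "(p * c) ^ n \<noteq> 0"
    using degree_pos c by simp
  then have "(of_nat (card T ^ \<tau> * W) :: complex) = of_int (z * int ((p * c) ^ n))"
    using z by (simp add: field_simps)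
  then have "int (card T ^ \<tau> * W) = z * int ((p * c) ^ n)"
    by (metis of_int_eq_iff of_int_of_nat_eq)
  then have "(p * c) ^ n dvd card T ^ \<tau> * W"
    by (metis dvd_triv_right int_dvd_int_iff)
  then have "p ^ n dvd card T ^ \<tau> * W"
    by (metis dvd_mult_left power_mult_distrib)
  then have "p ^ n dvd card T ^ \<tau>"
    using cop by (simp add: coprime_dvd_mult_left_iff)
  then have "p ^ n \<le> card T ^ \<tau>"
    using degree_pos by (simp add: dvd_imp_le)
  moreover have "2 ^ k \<le> p ^ k" for k
    using prime_ge_2_nat[OF assms(3)] by (simp add: power_mono)
  then have "a < n" "n < p ^ n"
    unfolding n_def by (meson less_exp less_le_trans)+
  moreover have "card T ^ \<tau> \<le> a"
  proof -
    have "card (carrier R) > 0"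
      using fin by (auto simp: card_gt_0_iff)
    then have "1 \<le> totient (card (carrier R))"
      by (simp add: Suc_le_eq)
    from mult_le_mono1[OF this, of "card T ^ \<tau>"] show ?thesis
      by (simp add: a_def)
  qed
  ultimately show False
    by simp
qed

section \<open>Direct products and transport along ring homomorphisms\<close>

lemma nth_ring_hom_RDirProd_list:
  assumes "i < length Ls"
  shows "(\<lambda>xs. xs ! i) \<in> ring_hom (RDirProd_list Ls) (Ls ! i)"
  using assms
proof (induction Ls arbitrary: i)
  case (Cons L Ls)
  let ?P = "RDirProd L (RDirProd_list Ls)" and ?S = "RDirProd_list (L # Ls)"
  have hom: "(\<lambda>(a, as). a # as) \<in> ring_hom ?P ?S"
    by (rule RDirProd_list_hom1)
  have carrier: "carrier ?S = (\<lambda>(a, as). a # as) ` carrier ?P"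
    unfolding RDirProd_list_carrier RDirProd_carrier ..
  \<comment> \<open>The operations on nonempty lists are read off from the homomorphism that sends a
    pair to its cons.\<close>
  have mult: "(a # as) \<otimes>\<^bsub>?S\<^esub> (b # bs) = (a \<otimes>\<^bsub>L\<^esub> b) # (as \<otimes>\<^bsub>RDirProd_list Ls\<^esub> bs)"
    and add: "(a # as) \<oplus>\<^bsub>?S\<^esub> (b # bs) = (a \<oplus>\<^bsub>L\<^esub> b) # (as \<oplus>\<^bsub>RDirProd_list Ls\<^esub> bs)"
    if "a \<in> carrier L" "as \<in> carrier (RDirProd_list Ls)" "b \<in> carrier L" "bs \<in> carrier (RDirProd_list Ls)"
    for a as b bs
    using ring_hom_mult[OF hom, of "(a, as)" "(b, bs)"] ring_hom_add[OF hom, of "(a, as)" "(b, bs)"] that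
    by (simp_all add: RDirProd_carrier) (simp_all add: RDirProd_def DirProd_def monoid.defs)
  have one: "\<one>\<^bsub>?S\<^esub> = \<one>\<^bsub>L\<^esub> # \<one>\<^bsub>RDirProd_list Ls\<^esub>"
    by (simp add: RDirProd_list_one)
  show ?case
  proof (cases i)
    case 0
    then show ?thesis
      by (intro ring_hom_memI) (auto simp: carrier RDirProd_carrier mult add one)
  next
    case (Suc j)
    then have "(\<lambda>xs. xs ! j) \<in> ring_hom (RDirProd_list Ls) (Ls ! j)"
      using Cons by simp
    note this' = ring_hom_closed[OF this] ring_hom_mult[OF this] ring_hom_add[OF this] ring_hom_one[OF this]
    show ?thesis
      using this' Suc by (intro ring_hom_memI) (auto simp: carrier RDirProd_carrier mult add one)
  qed
qed simp

lemma card_RDirProd_list: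
  "card (carrier (RDirProd_list Ls)) = (\<Prod>L\<leftarrow>Ls. card (carrier L))"
proof (induction Ls)
  case (Cons L Ls)
  then show ?case
    by (simp add: RDirProd_list_carrier card_image inj_on_def card_cartesian_product)
qed simp

lemma ring_hom_signed_unit_squares:
  assumes "cring R" "cring S" and h: "h \<in> ring_hom R S" and x: "x \<in> signed_unit_squares R"
  shows "h x \<in> signed_unit_squares S"
proof -
  interpret R: cring R by fact
  interpret S: cring S by fact
  interpret h: ring_hom_cring R S h
    using h by unfold_locales
  have unit: "h u \<in> Units S" if "u \<in> Units R" for u
  proof -
    have "h (inv\<^bsub>R\<^esub> u) \<otimes>\<^bsub>S\<^esub> h u = \<one>\<^bsub>S\<^esub>"
      using h.hom_mult[of "inv\<^bsub>R\<^esub> u" u] that R.Units_closed[OF that] by simp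
    then show ?thesis
      using that S.m_comm[of "h u" "h (inv\<^bsub>R\<^esub> u)"] R.Units_closed[OF that] R.Units_inv_closed[OF that]
      unfolding Units_def by auto
  qed
  obtain u where u: "u \<in> Units R"
    and x_eq: "x = u [^]\<^bsub>R\<^esub> (2::nat) \<or> x = \<ominus>\<^bsub>R\<^esub> (u [^]\<^bsub>R\<^esub> (2::nat))"
    using x by (auto simp: signed_unit_squares_def unit_squares_def)
  have "h x = h u [^]\<^bsub>S\<^esub> (2::nat) \<or> h x = \<ominus>\<^bsub>S\<^esub> (h u [^]\<^bsub>S\<^esub> (2::nat))"
    using x_eq R.Units_closed[OF u] by auto
  then show ?thesis
    using unit[OF u] unfolding signed_unit_squares_def unit_squares_def by blast
qed

lemma ring_iso_image_signed_unit_squares: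
  assumes "cring R" "cring S" and h: "h \<in> ring_iso R S"
  shows "h ` signed_unit_squares R = signed_unit_squares S"
proof (intro equalityI subsetI)
  fix y assume "y \<in> h ` signed_unit_squares R"
  then show "y \<in> signed_unit_squares S"
    using ring_hom_signed_unit_squares[OF assms(1,2)] h by (auto simp: ring_iso_def)
next
  fix y assume y: "y \<in> signed_unit_squares S"
  have "y \<in> carrier S"
    using y cring.signed_unit_squares_subset_Units[OF \<open>cring S\<close>] by (auto simp: Units_def)
  moreover have "bij_betw h (carrier R) (carrier S)"
    using h by (simp add: ring_iso_def)
  ultimately have "h (inv_into (carrier R) h y) = y"
    by (simp add: bij_betw_inv_into_right)
  moreover have "inv_into (carrier R) h \<in> ring_iso S R"
    using ring_iso_set_sym[OF _ h] cring.axioms(1)[OF \<open>cring R\<close>] by blast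
  then have "inv_into (carrier R) h y \<in> signed_unit_squares R"
    using ring_hom_signed_unit_squares[OF assms(2,1) _ y] by (auto simp: ring_iso_def)
  ultimately show "y \<in> h ` signed_unit_squares R"
    by force
qed

text \<open>The element e with coordinate -1 at index 1 and 1 elsewhere is a square, since -1 is a
  square in the factor with index 1. It differs from 1 at index 1 and from -1 at index 0, so 4
  divides |T|. As |R| is odd, the criterion with p = 2 excludes periodicity.\<close>

lemma (in cring) not_grover_periodic_of_several_factors:
  fixes Ls :: "nat \<Rightarrow> ('c, 'd) ring_scheme"
  assumes fin: "finite (carrier R)" and iso: "h \<in> ring_iso R (RDirProd_list (map Ls [0..<Suc s]))"
    and local: "\<And>i. i \<le> s \<Longrightarrow> finite_local_ring (Ls i) (M i) (q i)"
    and q0: "q 0 mod 4 = 3" and q: "\<And>i. 1 \<le> i \<Longrightarrow> i \<le> s \<Longrightarrow> q i mod 4 = 1" and "s \<ge> 1"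
  shows "\<not> grover_periodic (quadratic_unitary_cayley_graph R)"
proof -
  let ?Ls = "map Ls [0..<Suc s]"
  have nth: "?Ls ! i = Ls i" if "i \<le> s" for i
    using that by (simp add: nth_append del: upt_Suc)
  have len: "length ?Ls = Suc s"
    by simp
  have odd_q: "odd (q i)" if "i \<le> s" for i
  proof (cases "i = 0")
    case True
    then show ?thesis using q0 by presburger
  next
    case False
    then have "q i mod 4 = 1"
      using q[of i] that by simp
    then show ?thesis by presburger
  qed
  have bij: "bij_betw h (carrier R) (carrier (RDirProd_list ?Ls))"
    and hom: "h \<in> ring_hom R (RDirProd_list ?Ls)"
    using iso by (auto simp: ring_iso_def)
  define \<pi> where "\<pi> = (\<lambda>i x. h x ! i)"
  have \<pi>: "\<pi> i \<in> ring_hom R (Ls i)" if "i \<le> s" for i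
    using ring_hom_trans[OF hom nth_ring_hom_RDirProd_list[of i ?Ls]] that
    by (simp add: nth \<pi>_def comp_def del: upt_Suc)
  have ext: "x = y" if "x \<in> carrier R" "y \<in> carrier R" "\<And>i. i \<le> s \<Longrightarrow> \<pi> i x = \<pi> i y" for x y
  proof -
    have "h x \<in> carrier (RDirProd_list ?Ls)" "h y \<in> carrier (RDirProd_list ?Ls)"
      using bij that(1,2) by (auto dest: bij_betwE)
    then have "length (h x) = Suc s" "length (h y) = Suc s"
      using RDirProd_list_carrier_mem(1) len by metis+
    then have "h x = h y"
      using that(3) by (intro nth_equalityI) (auto simp: \<pi>_def less_Suc_eq_le)
    then show ?thesis
      using bij that(1,2) by (auto simp: bij_betw_def inj_on_def)
  qed
  have preimage: "\<exists>x\<in>carrier R. \<forall>i\<le>s. \<pi> i x = f i" if "\<And>i. i \<le> s \<Longrightarrow> f i \<in> carrier (Ls i)" for f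
  proof -
    have "map f [0..<Suc s] \<in> carrier (RDirProd_list ?Ls)"
    proof (rule RDirProd_list_carrier_memI)
      fix i assume "i < length ?Ls"
      then have "i \<le> s"
        by simp
      moreover have "map f [0..<Suc s] ! i = f i"
        using \<open>i \<le> s\<close> by (simp add: nth_append del: upt_Suc)
      ultimately show "map f [0..<Suc s] ! i \<in> carrier (?Ls ! i)"
        using that nth by metis
    qed simp
    then obtain x where "x \<in> carrier R" "h x = map f [0..<Suc s]"
      using bij by (metis bij_betw_imp_surj_on imageE)
    then show ?thesis
      by (intro bexI[of _ x]) (simp_all add: \<pi>_def nth_append del: upt_Suc)
  qed

  interpret L1: finite_local_ring "Ls 1" "M 1" "q 1"
    using \<open>s \<ge> 1\<close> by (rule local)
  interpret L0: finite_local_ring "Ls 0" "M 0" "q 0"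
    by (rule local) simp
  have cring: "cring (Ls i)" if "i \<le> s" for i
    using local[OF that] by (simp add: finite_local_ring_def)
  have hom_cring: "ring_hom_cring R (Ls i) (\<pi> i)" if "i \<le> s" for i
    using \<pi>[OF that] cring[OF that] is_cring
    by (simp add: ring_hom_cring_def ring_hom_cring_axioms_def)
  obtain j where j: "j \<in> carrier (Ls 1)" "j \<otimes>\<^bsub>Ls 1\<^esub> j = \<ominus>\<^bsub>Ls 1\<^esub> \<one>\<^bsub>Ls 1\<^esub>"
    using L1.minus_one_square q \<open>s \<ge> 1\<close> by blast
  obtain a where a: "a \<in> carrier R" "\<And>i. i \<le> s \<Longrightarrow> \<pi> i a = (if i = 1 then j else \<one>\<^bsub>Ls i\<^esub>)"
  proof -
    have "(if i = 1 then j else \<one>\<^bsub>Ls i\<^esub>) \<in> carrier (Ls i)" if "i \<le> s" for i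
      using j(1) cring.cring_simprules(6)[OF cring[OF that]] by simp
    from preimage[OF this] show thesis
      using that by blast
  qed
  define e where "e = a \<otimes> a"
  have e: "e \<in> carrier R"
    using a(1) by (simp add: e_def)
  have \<pi>_e: "\<pi> i e = (if i = 1 then \<ominus>\<^bsub>Ls 1\<^esub> \<one>\<^bsub>Ls 1\<^esub> else \<one>\<^bsub>Ls i\<^esub>)" if "i \<le> s" for i
  proof -
    interpret h: ring_hom_cring R "Ls i" "\<pi> i"
      by (rule hom_cring[OF that])
    show ?thesis
      using a that j by (simp add: e_def)
  qed
  have minus_one: "\<ominus>\<^bsub>Ls 1\<^esub> \<one>\<^bsub>Ls 1\<^esub> \<otimes>\<^bsub>Ls 1\<^esub> \<ominus>\<^bsub>Ls 1\<^esub> \<one>\<^bsub>Ls 1\<^esub> = \<one>\<^bsub>Ls 1\<^esub>"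
    by (simp only: L1.l_minus L1.l_one L1.minus_minus L1.one_closed L1.a_inv_closed)
  have "e \<otimes> e = \<one>"
  proof (rule ext)
    fix i assume i: "i \<le> s"
    interpret h: ring_hom_cring R "Ls i" "\<pi> i"
      by (rule hom_cring[OF i])
    show "\<pi> i (e \<otimes> e) = \<pi> i \<one>"
      using \<pi>_e[OF i] e minus_one by auto
  qed (simp_all add: e)
  moreover have "e \<in> unit_squares R"
  proof -
    \<comment> \<open>From a^4 = 1 the cube of \<open>a\<close> is its inverse, which makes e the
      square of a unit.\<close>
    have "a \<otimes> (a \<otimes> (a \<otimes> a)) = \<one>"
      using \<open>e \<otimes> e = \<one>\<close> a(1) by (simp add: e_def m_assoc)
    then have "a \<in> Units R"
      using a(1) unfolding Units_def by (auto simp: m_comm m_assoc intro!: bexI[of _ "a \<otimes> (a \<otimes> a)"])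
    moreover have "e = a [^] (2 :: nat)"
      using a(1) by (simp add: e_def numeral_2_eq_2)
    ultimately show ?thesis
      unfolding unit_squares_def by blast
  qed
  moreover have "e \<noteq> \<one>" "\<one> \<noteq> \<ominus> \<one>"
  proof -
    interpret h: ring_hom_cring R "Ls 1" "\<pi> 1"
      using \<open>s \<ge> 1\<close> by (intro hom_cring)
    have "\<one>\<^bsub>Ls 1\<^esub> \<noteq> \<ominus>\<^bsub>Ls 1\<^esub> \<one>\<^bsub>Ls 1\<^esub>"
      by (rule L1.one_neq_minus_one[OF odd_q[OF \<open>s \<ge> 1\<close>]])
    moreover have "\<pi> 1 \<one> = \<one>\<^bsub>Ls 1\<^esub>" "\<pi> 1 (\<ominus> \<one>) = \<ominus>\<^bsub>Ls 1\<^esub> \<one>\<^bsub>Ls 1\<^esub>"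
      using h.hom_one h.hom_a_inv[OF one_closed] by (simp_all only:)
    moreover have "\<pi> 1 e = \<ominus>\<^bsub>Ls 1\<^esub> \<one>\<^bsub>Ls 1\<^esub>"
      using \<pi>_e[OF \<open>s \<ge> 1\<close>] by (simp only: simp_thms if_True)
    ultimately show "e \<noteq> \<one>" "\<one> \<noteq> \<ominus> \<one>"
      by metis+
  qed
  moreover have "e \<noteq> \<ominus> \<one>"
  proof
    interpret h: ring_hom_cring R "Ls 0" "\<pi> 0"
      by (intro hom_cring) simp
    assume "e = \<ominus> \<one>"
    then have "\<pi> 0 e = \<ominus>\<^bsub>Ls 0\<^esub> \<one>\<^bsub>Ls 0\<^esub>"
      by simp
    then show False
      using \<pi>_e[of 0] L0.one_neq_minus_one odd_q[of 0] by simp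
  qed
  ultimately have four: "4 dvd card (signed_unit_squares R)"
    by (intro four_dvd_card_signed_unit_squares[OF fin])
  have "card (carrier R) = (\<Prod>L\<leftarrow>?Ls. card (carrier L))"
    using bij_betw_same_card[OF bij] by (simp only: card_RDirProd_list)
  moreover have "odd (card (carrier L))" if "L \<in> set ?Ls" for L
    using that finite_local_ring.odd_card_carrier[OF local odd_q] by auto
  moreover have "odd (\<Prod>L\<leftarrow>Xs. card (carrier L))" if "\<And>L. L \<in> set Xs \<Longrightarrow> odd (card (carrier L))"
    for Xs :: "('c, 'd) ring_scheme list"
    using that by (induction Xs) auto
  ultimately have "\<not> 2 dvd card (carrier R)"
    by metis
  moreover have "\<one> \<noteq> \<zero>"
    using \<open>\<one> \<noteq> \<ominus> \<one>\<close> by (metis minus_zero)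
  ultimately show ?thesis
    using grover_periodic_imp_not_dvd[OF fin _ two_is_prime_nat] four by auto
qed

text \<open>Here |T| = (q - 1) |M|. A prime p dividing (q - 1) / 2 is coprime to q, hence to |R|,
  while 2 p divides |T|; so periodicity leaves only (q - 1) / 2 = 1. For q = 3 the three cosets of M
  are the parts of a complete tripartite graph.\<close>

lemma (in cring) grover_periodic_local_iff:
  assumes fin: "finite (carrier R)" and h: "h \<in> ring_iso R L"
    and local: "finite_local_ring L M q" and q: "q mod 4 = 3"
  shows "grover_periodic (quadratic_unitary_cayley_graph R) \<longleftrightarrow> q = 3"
proof -
  let ?G = "quadratic_unitary_cayley_graph R"
  interpret L: finite_local_ring L M q
    by (rule local)
  interpret h: ring_hom_cring R L h
    using h by unfold_locales (simp add: ring_iso_def)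
  have bij: "bij_betw h (carrier R) (carrier L)"
    using h by (simp add: ring_iso_def)
  have one: "\<one> \<noteq> \<zero>"
    using L.one_neq_zero h.hom_one h.hom_zero by metis
  have T: "h ` signed_unit_squares R = Units L"
    using ring_iso_image_signed_unit_squares[OF is_cring L.is_cring h] L.signed_unit_squares_eq_Units[OF q]
    by simp
  have T_sub: "signed_unit_squares R \<subseteq> carrier R"
    using signed_unit_squares_subset_Units Units_closed by blast
  have inj: "inj_on h (carrier R)"
    using bij by (rule bij_betw_imp_inj_on)
  have card_T: "card (signed_unit_squares R) = (q - 1) * card M"
    using card_image[OF inj_on_subset[OF inj T_sub]] by (simp add: T L.card_Units)
  show ?thesis
  proof
    assume periodic: "grover_periodic ?G"
    show "q = 3"
    proof (rule ccontr)
      assume "q \<noteq> 3"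
      define r where "r = (q - 1) div 2"
      have r: "q - 1 = 2 * r" "r \<noteq> 1"
        using q \<open>q \<noteq> 3\<close> unfolding r_def by presburger+
      obtain p where p: "Factorial_Ring.prime p" "p dvd r"
        using prime_factor_nat[OF r(2)] by blast
      have "\<not> p dvd q"
      proof
        assume "p dvd q"
        moreover have "p dvd q - 1"
          using p r by simp
        ultimately have "p dvd q - (q - 1)"
          by (rule dvd_diff_nat)
        moreover have "q - (q - 1) = 1"
          using q by presburger
        ultimately show False
          using p by simp
      qed
      then have "\<not> p dvd card (carrier R)"
        using L.prime_dvd_residue_card[OF p(1)] bij_betw_same_card[OF bij] by auto
      then have "\<not> 2 * p dvd card (signed_unit_squares R)"
        by (rule grover_periodic_imp_not_dvd[OF fin one p(1) _ periodic])
      then show False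
        using p(2) r(1) by (simp add: card_T mult_dvd_mono dvd_mult2)
    qed
  next
    assume "q = 3"
    interpret regular_graph ?G "card (signed_unit_squares R)"
      by (rule regular_graph_quadratic_unitary_cayley_graph[OF fin one])
    have pverts: "pverts ?G = carrier R"
      by (simp add: quadratic_unitary_cayley_graph_def cayley_graph_def)
    \<comment> \<open>A difference is a unit exactly when it lies outside M, that is, when the two
      images lie in different cosets.\<close>
    have arcs: "(u, v) \<in> parcs ?G \<longleftrightarrow> M +>\<^bsub>L\<^esub> h u \<noteq> M +>\<^bsub>L\<^esub> h v"
      if uv: "u \<in> carrier R" "v \<in> carrier R" for u v
    proof -
      have "(u, v) \<in> parcs ?G \<longleftrightarrow> u \<noteq> v \<and> h (u \<ominus> v) \<in> Units L"
        using uv T_sub inj_on_image_mem_iff[OF inj _ T_sub, of "u \<ominus> v"] T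
        by (auto simp: quadratic_unitary_cayley_graph_def cayley_graph_def)
      also have "h (u \<ominus> v) = h u \<ominus>\<^bsub>L\<^esub> h v"
        using uv by (simp add: a_minus_def)
      also have "\<dots> \<in> Units L \<longleftrightarrow> M +>\<^bsub>L\<^esub> h u \<noteq> M +>\<^bsub>L\<^esub> h v"
        using uv L.quotient_eq_iff_same_a_r_cos[OF L.M.is_ideal, of "h u" "h v"]
        by (simp add: L.Units_eq)
      finally show ?thesis
        by auto
    qed
    have card_class: "card {v \<in> carrier R. M +>\<^bsub>L\<^esub> h v = M +>\<^bsub>L\<^esub> h u} = card M" if u: "u \<in> carrier R" for u
    proof -
      have sub: "M +>\<^bsub>L\<^esub> h u \<subseteq> carrier L"
        using L.a_r_coset_subset_G[OF L.M_subset] u by simp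
      have "y \<in> M +>\<^bsub>L\<^esub> h u \<longleftrightarrow> M +>\<^bsub>L\<^esub> y = M +>\<^bsub>L\<^esub> h u" if "y \<in> carrier L" for y
        using L.M.a_repr_independence'[of y "h u"] L.M.a_rcos_self[OF that] u by auto
      then have "h ` {v \<in> carrier R. M +>\<^bsub>L\<^esub> h v = M +>\<^bsub>L\<^esub> h u} = M +>\<^bsub>L\<^esub> h u"
        using sub unfolding bij_betw_imp_surj_on[OF bij, symmetric] by blast
      then have "card {v \<in> carrier R. M +>\<^bsub>L\<^esub> h v = M +>\<^bsub>L\<^esub> h u} = card (M +>\<^bsub>L\<^esub> h u)"
        using card_image[OF inj_on_subset[OF inj], of "{v \<in> carrier R. M +>\<^bsub>L\<^esub> h v = M +>\<^bsub>L\<^esub> h u}"] by simp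
      also have "\<dots> = card M"
        using u L.a_card_cosets_equal[OF _ L.M_subset L.finite_carrier] by (simp add: L.a_rcosetsI L.M_subset)
      finally show ?thesis .
    qed
    show "grover_periodic ?G"
    proof (rule tripartite_imp_grover_periodic[where col = "\<lambda>u. M +>\<^bsub>L\<^esub> h u" and m = "card M"])
      show "card (pverts ?G) = 3 * card M"
        using bij_betw_same_card[OF bij] \<open>q = 3\<close> by (simp add: pverts L.card_carrier)
    qed (simp_all add: pverts arcs card_class)
  qed
qed

theorem theorem5p10:
  fixes R :: "('a, 'm) ring_scheme"
    and s :: nat
    and Rs :: "nat \<Rightarrow> ('b, 'n) ring_scheme"
    and M :: "nat \<Rightarrow> 'b set"
  assumes "cring R" and "finite (carrier R)"
    and "R \<simeq> RDirProd_list (map Rs [0..<Suc s])"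
    and "\<And>i. i \<le> s \<Longrightarrow> local_ring (Rs i)"
    and "\<And>i. i \<le> s \<Longrightarrow> finite (carrier (Rs i))"
    and "\<And>i. i \<le> s \<Longrightarrow> maximalideal (M i) (Rs i)"
    and "(card (carrier (Rs 0)) div card (M 0)) mod 4 = 3"
    and "\<And>i. i \<in> {1..s} \<Longrightarrow> (card (carrier (Rs i)) div card (M i)) mod 4 = 1"
  shows "grover_periodic (quadratic_unitary_cayley_graph R) \<longleftrightarrow>
    s = 0 \<and> (Rs 0 Quot M 0) \<simeq> ZFact 3"
proof -
  interpret cring R by fact
  define q where "q i = card (carrier (Rs i)) div card (M i)" for i
  have local: "finite_local_ring (Rs i) (M i) (q i)" if "i \<le> s" for i
    using assms(4-6)[OF that]
    by (simp add: finite_local_ring_def finite_local_ring_axioms_def local_ring_def q_def)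
  obtain h where h: "h \<in> ring_iso R (RDirProd_list (map Rs [0..<Suc s]))"
    using assms(3) by (auto simp: is_ring_iso_def)
  show ?thesis
  proof (cases "s = 0")
    case True
    interpret L: finite_local_ring "Rs 0" "M 0" "q 0"
      by (rule local) simp
    \<comment> \<open>The product over a one-element list consists of one-element lists, so it is
      only isomorphic to its factor.\<close>
    obtain g where g: "g \<in> ring_iso (RDirProd_list [Rs 0]) (Rs 0)"
      using ring_iso_set_sym[OF L.ring_axioms RDirProd_list_iso3] by blast
    have "g \<circ> h \<in> ring_iso R (Rs 0)"
      using ring_iso_set_trans[OF _ g] h True by simp
    then have "grover_periodic (quadratic_unitary_cayley_graph R) \<longleftrightarrow> q 0 = 3"
      using grover_periodic_local_iff[OF assms(2) _ local] assms(7) by (simp add: q_def)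
    also have "q 0 = 3 \<longleftrightarrow> (Rs 0 Quot M 0) \<simeq> ZFact 3"
    proof
      assume "q 0 = 3"
      then show "(Rs 0 Quot M 0) \<simeq> ZFact 3"
        using cring.iso_ZFact_of_card_prime[OF L.M.quotient_is_cring[OF L.is_cring], of 3] L.card_quotient
        by simp
    next
      assume "(Rs 0 Quot M 0) \<simeq> ZFact 3"
      then have "card (carrier (Rs 0 Quot M 0)) = card (carrier (ZFact (int 3)))"
        by (auto simp: is_ring_iso_def ring_iso_def dest: bij_betw_same_card)
      then show "q 0 = 3"
        by (simp only: card_ZFact L.card_quotient)
    qed
    finally show ?thesis
      using True by simp
  next
    case False
    then have "\<not> grover_periodic (quadratic_unitary_cayley_graph R)"
    proof (intro not_grover_periodic_of_several_factors[OF assms(2) h, where M = M and q = q])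
      show "q 0 mod 4 = 3" "\<And>i. 1 \<le> i \<Longrightarrow> i \<le> s \<Longrightarrow> q i mod 4 = 1"
        using assms(7,8) by (simp_all add: q_def)
    qed (use False local in simp_all)
    then show ?thesis
      using False by simp
  qed
qed

end
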